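(* There exists a covering of $\mathbb{R}^3$ by a (single) self-avoiding curve which is locally isomorphic to the sets $\widehat{\mathcal{C}}_R$ for $R$ satisfying (P).
   Context: Curves. Let $(e_1,e_2,e_3)$ be the canonical basis of $\mathbb{R}^3$ and $E=\{e_1,-e_1,e_2,-e_2,e_3,-e_3\}$. A segment is a non-oriented interval $[x,x+e_i]$ with $x\in\mathbb{Z}^3$. A curve is a nonoriented sequence of segments, finite or indexed by $\mathbb{N}$ or by $\mathbb{Z}$, such that (i) two consecutive segments have one and only one common endpoint, and (ii) the common endpoints of a segment with the preceding one and with the following one, when these exist, are different. Two consecutive segments of a curve are said to be connected at their common endpoint (a connexion). A curve is self-avoiding if each of its segments appears only once; curves are disjoint if they have no common segment. A set of self-avoiding curves is a covering of $\mathbb{R}^3$ if each segment appears in one and only one of its curves. The covering $\mathcal{C}$. Write $\overline{m}=-m$. Let $\mathcal{B}_0$ be the set of the $6$ curves with successive vertices $((0,0,0),(0,\overline{1},0),(0,\overline{1},\overline{1}),(0,0,\overline{1}),(1,0,\overline{1}),(1,\overline{1},\overline{1}),(1,\overline{1},0),(1,0,0),(2,0,0))$, $((0,0,0),(0,0,1),(0,1,1),(0,1,0),(\overline{1},1,0),(\overline{1},1,1),(\overline{1},0,1),(\overline{1},0,0),(\overline{2},0,0))$, $((0,0,0),(0,0,\overline{1}),(\overline{1},0,\overline{1}),(\overline{1},0,0),(\overline{1},1,0),(\overline{1},1,\overline{1}),(0,1,\overline{1}),(0,1,0),(0,2,0))$, $((0,0,0),(1,0,0),(1,0,1),(0,0,1),(0,\overline{1},1),(1,\overline{1},1),(1,\overline{1},0),(0,\overline{1},0),(0,\overline{2},0))$,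 $((0,0,0),(\overline{1},0,0),(\overline{1},\overline{1},0),(0,\overline{1},0),(0,\overline{1},1),(\overline{1},\overline{1},1),(\overline{1},0,1),(0,0,1),(0,0,2))$, $((0,0,0),(0,1,0),(1,1,0),(1,0,0),(1,0,\overline{1}),(1,1,\overline{1}),(0,1,\overline{1}),(0,0,\overline{1}),(0,0,\overline{2}))$. Let $\mathcal{B}_1,\mathcal{B}_2,\mathcal{B}_3$ be the images of $\mathcal{B}_0$ by the isometries $(a,b,c)\mapsto(2+a,2-b,-c)$, $(a,b,c)\mapsto(2-a,-b,2+c)$, $(a,b,c)\mapsto(-a,2+b,2-c)$ respectively. $\mathcal{C}$ is the set of all translates $4u+D$ with $u\in\mathbb{Z}^3$ and $D\in\mathcal{B}_0\cup\mathcal{B}_1\cup\mathcal{B}_2\cup\mathcal{B}_3$. It is a covering of $\mathbb{R}^3$, invariant under translations by $4\mathbb{Z}^3$; each of its curves joins two points $2x,2x+2e_i$ ($x\in\mathbb{Z}^3$), and any two such points are joined by a unique curve of $\mathcal{C}$. Powers and limit. For a set $\mathcal{D}$ of disjoint self-avoiding curves, $\mathcal{C}\ast\mathcal{D}$ is obtained by applying to $\mathcal{D}$ the homothety of center $0$ and ratio $2$, then replacing each resulting interval by the curve of $\mathcal{C}$ with the same endpoints. $\mathcal{C}^0$ is the set of all one-segment curves and $\mathcal{C}^{s+1}=\mathcal{C}\ast\mathcal{C}^s$; each connexion of $\mathcal{C}^s$ is also a connexion of $\mathcal{C}^{s+1}$. $\widehat{\mathcal{C}}$ is the inductive limit of the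 $\mathcal{C}^s$ (two segments are connected in $\widehat{\mathcal{C}}$ iff they are connected in some $\mathcal{C}^s$); its connexions are defined at every point of $\mathbb{Z}^3$ except $0$. A pairing relation on $E$ partitions $E$ into pairs of distinct related elements; for such $R$, $\widehat{\mathcal{C}}_R$ is the set of curves without endpoints obtained from $\widehat{\mathcal{C}}$ by connecting $[0,u]$ and $[0,v]$ iff $R(u,v)$. Property (P). For $x\in\mathbb{Z}^3-\{0\}$ and $u,v\in E$, write $R_x(u,v)$ if the segments $[x,x+u]$ and $[x,x+v]$ are connected in $\widehat{\mathcal{C}}$. Let $\theta$ be the permutation of $E$ with $\theta(e_1)=-e_2$, $\theta(e_2)=-e_3$, $\theta(e_3)=-e_1$, $\theta^2=\mathrm{Id}$. For a relation $R$ on $E$, $R^\theta(u,v)$ holds iff $R(\theta(u),\theta(v))$. A pairing relation $R$ satisfies (P) if there exists $x\in\{-2,0,2,4\}^3-\{0,4\}^3$ such that $R_x=R$ or $R_x=R^\theta$. Local isomorphism. For $x\in\mathbb{Z}^3$, $h\in\mathbb{N}^{\ast}$, $\mathrm{P}_{x,h}=\{y\in\mathbb{R}^3: |y_i-x_i|\le h,\ i=1,2,3\}$, and $\mathcal{E}\upharpoonright\mathrm{P}_{x,h}$ denotes the segments of $\mathcal{E}$ contained in $\mathrm{P}_{x,h}$ with the connexions of $\mathcal{E}$ between them; $\cong$ means equality up to translation. Sets of curves $\mathcal{E},\mathcal{F}$ are locally isomorphic if for each $h\in\mathbb{N}^{\ast}$ and each $x\in\mathbb{Z}^3$ there is $y\in\mathbb{Z}^3$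 with $\mathcal{E}\upharpoonright\mathrm{P}_{x,h}\cong\mathcal{F}\upharpoonright\mathrm{P}_{y,h}$, and for each $h\in\mathbb{N}^{\ast}$ and each $y\in\mathbb{Z}^3$ there is $x\in\mathbb{Z}^3$ with $\mathcal{E}\upharpoonright\mathrm{P}_{x,h}\cong\mathcal{F}\upharpoonright\mathrm{P}_{y,h}$. *)

theory Defs
  imports Main "HOL-Library.Product_Plus"
begin

type_synonym point = "int \<times> int \<times> int"

text \<open>A segment is encoded by the set of its two endpoints. Two distinct segments meet, if at all,
  in a common endpoint, and a segment lies in a box iff both of its endpoints do.\<close>
type_synonym segment = "point set"

text \<open>A sequence of segments is a partial function on the integers whose domain is a nonempty
  interval (finite, a half-line, or all of the integers). A curve, being nonoriented, is the class of
  a sequence modulo the reindexings \<open>i \<mapsto> k + i\<close> and \<open>i \<mapsto> k - i\<close>; in particular every sequence on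
  a half-line is equivalent to one indexed by the natural numbers.\<close>
type_synonym segseq = "int \<rightharpoonup> segment"
type_synonym curve = "segseq set"

fun scale :: "int \<Rightarrow> point \<Rightarrow> point" where
  "scale k (a, b, c) = (k * a, k * b, k * c)"

definition e1 :: point where "e1 = (1, 0, 0)"
definition e2 :: point where "e2 = (0, 1, 0)"
definition e3 :: point where "e3 = (0, 0, 1)"

definition directions :: "point set" where
  "directions = {e1, - e1, e2, - e2, e3, - e3}"

definition segments :: "segment set" where
  "segments = {{x, x + e} | x e. e \<in> {e1, e2, e3}}"

definition curve_seq :: "segseq \<Rightarrow> bool" where
  "curve_seq f \<longleftrightarrow>
     dom f \<noteq> {} \<and> (\<forall>i\<in>dom f. \<forall>j\<in>dom f. {i..j} \<subseteq> dom f) \<and> ran f \<subseteq> segments \<and>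
     (\<forall>i s t. f i = Some s \<and> f (i + 1) = Some t \<longrightarrow> card (s \<inter> t) = 1) \<and>
     (\<forall>i r s t. f (i - 1) = Some r \<and> f i = Some s \<and> f (i + 1) = Some t \<longrightarrow> r \<inter> s \<noteq> s \<inter> t)"

definition nonoriented :: "segseq \<Rightarrow> curve" where
  "nonoriented f = {g. \<exists>k. g = (\<lambda>i. f (k + i)) \<or> g = (\<lambda>i. f (k - i))}"

definition curves :: "curve set" where
  "curves = nonoriented ` {f. curve_seq f}"

definition segs_of :: "curve \<Rightarrow> segment set" where
  "segs_of \<gamma> = (\<Union>f\<in>\<gamma>. ran f)"

definition self_avoiding :: "curve \<Rightarrow> bool" where
  "self_avoiding \<gamma> \<longleftrightarrow> (\<forall>f\<in>\<gamma>. inj_on f (dom f))"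

definition covering :: "curve set \<Rightarrow> bool" where
  "covering F \<longleftrightarrow> F \<subseteq> curves \<and> (\<forall>\<gamma>\<in>F. self_avoiding \<gamma>) \<and>
     (\<forall>s\<in>segments. \<exists>!\<gamma>. \<gamma> \<in> F \<and> s \<in> segs_of \<gamma>)"

text \<open>The pairs of consecutive segments of the curves in a set. The relation is symmetric because a
  curve contains its reversals; the point of connexion is the unique common endpoint.\<close>
definition connexions :: "curve set \<Rightarrow> (segment \<times> segment) set" where
  "connexions F = {(s, t). \<exists>\<gamma>\<in>F. \<exists>f\<in>\<gamma>. \<exists>i. f i = Some s \<and> f (i + 1) = Some t}"


subsection \<open>The covering \<open>\<C>\<close>\<close>

text \<open>The sequence of segments of a finite curve given by its successive vertices.\<close>
definition vertex_path :: "point list \<Rightarrow> segseq" where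
  "vertex_path vs = (\<lambda>i. if 0 \<le> i \<and> i + 1 < int (length vs)
                         then Some {vs ! nat i, vs ! nat (i + 1)} else None)"

definition B0 :: "point list set" where
  "B0 = {
    [(0,0,0), (0,-1,0), (0,-1,-1), (0,0,-1), (1,0,-1), (1,-1,-1), (1,-1,0), (1,0,0), (2,0,0)],
    [(0,0,0), (0,0,1), (0,1,1), (0,1,0), (-1,1,0), (-1,1,1), (-1,0,1), (-1,0,0), (-2,0,0)],
    [(0,0,0), (0,0,-1), (-1,0,-1), (-1,0,0), (-1,1,0), (-1,1,-1), (0,1,-1), (0,1,0), (0,2,0)],
    [(0,0,0), (1,0,0), (1,0,1), (0,0,1), (0,-1,1), (1,-1,1), (1,-1,0), (0,-1,0), (0,-2,0)],
    [(0,0,0), (-1,0,0), (-1,-1,0), (0,-1,0), (0,-1,1), (-1,-1,1), (-1,0,1), (0,0,1), (0,0,2)],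
    [(0,0,0), (0,1,0), (1,1,0), (1,0,0), (1,0,-1), (1,1,-1), (0,1,-1), (0,0,-1), (0,0,-2)]}"

definition base_paths :: "point list set" where
  "base_paths = B0
     \<union> map (\<lambda>(a, b, c). (2 + a, 2 - b, - c)) ` B0
     \<union> map (\<lambda>(a, b, c). (2 - a, - b, 2 + c)) ` B0
     \<union> map (\<lambda>(a, b, c). (- a, 2 + b, 2 - c)) ` B0"

definition C_cov :: "curve set" where
  "C_cov = {nonoriented (vertex_path (map (\<lambda>p. scale 4 u + p) vs)) | u vs. vs \<in> base_paths}"


subsection \<open>Powers and limit\<close>

definition has_vertices :: "segseq \<Rightarrow> (int \<Rightarrow> point) \<Rightarrow> bool" where
  "has_vertices f v \<longleftrightarrow> (\<forall>i\<in>dom f. f i = Some {v i, v (i + 1)})"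

text \<open>\<open>replaces g f\<close>: \<open>g\<close> arises from \<open>f\<close> by doubling and then replacing the \<open>i\<close>-th interval by the
  curve of \<open>C_cov\<close> with the same endpoints. Every curve of \<open>C_cov\<close> has 8 segments, so the segments
  of \<open>g\<close> coming from the \<open>i\<close>-th one of \<open>f\<close> are those with indices from \<open>8 * i\<close> to \<open>8 * i + 7\<close>. The
  vertices \<open>v\<close> and \<open>w\<close> are needed to concatenate the replacing curves with matching orientations.\<close>
definition replaces :: "segseq \<Rightarrow> segseq \<Rightarrow> bool" where
  "replaces g f \<longleftrightarrow> dom g = {j. j div 8 \<in> dom f} \<and>
     (\<exists>v w. has_vertices f v \<and> has_vertices g w \<and>
        (\<forall>i\<in>dom f. w (8 * i) = scale 2 (v i) \<and> w (8 * i + 8) = scale 2 (v (i + 1)) \<and>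
           nonoriented (\<lambda>j. if 0 \<le> j \<and> j < 8 then g (8 * i + j) else None) \<in> C_cov))"

definition C_star :: "curve set \<Rightarrow> curve set" where
  "C_star D = {nonoriented g | g f \<delta>. \<delta> \<in> D \<and> f \<in> \<delta> \<and> replaces g f}"

primrec C_pow :: "nat \<Rightarrow> curve set" where
  "C_pow 0 = {nonoriented [0 \<mapsto> s] | s. s \<in> segments}"
| "C_pow (Suc n) = C_star (C_pow n)"

text \<open>The connexions of the inductive limit of the \<open>C_pow n\<close>.\<close>
definition C_hat_connexions :: "(segment \<times> segment) set" where
  "C_hat_connexions = (\<Union>n. connexions (C_pow n))"

text \<open>The set of curves obtained by following a symmetric connexion relation \<open>K\<close> on all segments as
  far as possible: consecutive segments are related, and every segment related to a segment of the
  curve is its predecessor or its successor. A curve stops only at an endpoint of a segment where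
  \<open>K\<close> gives no connexion.\<close>
definition curves_connected_by :: "(segment \<times> segment) set \<Rightarrow> curve set" where
  "curves_connected_by K = {nonoriented f | f. curve_seq f \<and>
     (\<forall>i s t. f i = Some s \<and> f (i + 1) = Some t \<longrightarrow> (s, t) \<in> K) \<and>
     (\<forall>i s t. f i = Some s \<and> (s, t) \<in> K \<longrightarrow> f (i - 1) = Some t \<or> f (i + 1) = Some t)}"

definition pairing :: "(point \<times> point) set \<Rightarrow> bool" where
  "pairing R \<longleftrightarrow> R \<subseteq> directions \<times> directions \<and> sym R \<and> irrefl R \<and>
     (\<forall>u\<in>directions. \<exists>!v. (u, v) \<in> R)"

text \<open>For a pairing \<open>R\<close> the relation below connects every segment at both of its endpoints, so that
  the resulting curves have no endpoints.\<close>
definition C_hat :: "(point \<times> point) set \<Rightarrow> curve set" where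
  "C_hat R = curves_connected_by (C_hat_connexions \<union> {({0, u}, {0, v}) | u v. (u, v) \<in> R})"


subsection \<open>Property (P)\<close>

definition R_at :: "point \<Rightarrow> (point \<times> point) set" where
  "R_at x = {(u, v). u \<in> directions \<and> v \<in> directions \<and> ({x, x + u}, {x, x + v}) \<in> C_hat_connexions}"

text \<open>\<open>theta\<close> is an involution of the six directions which does not commute with negation; its values
  outside \<open>directions\<close> are irrelevant.\<close>
definition theta :: "point \<Rightarrow> point" where
  "theta = id(e1 := - e2, - e2 := e1, e2 := - e3, - e3 := e2, e3 := - e1, - e1 := e3)"

definition twist :: "(point \<times> point) set \<Rightarrow> (point \<times> point) set" where
  "twist R = {(u, v). u \<in> directions \<and> v \<in> directions \<and> (theta u, theta v) \<in> R}"

definition satisfies_P :: "(point \<times> point) set \<Rightarrow> bool" where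
  "satisfies_P R \<longleftrightarrow> pairing R \<and>
     (\<exists>x \<in> {-2, 0, 2, 4} \<times> {-2, 0, 2, 4} \<times> {-2, 0, 2, 4} - {0, 4} \<times> {0, 4} \<times> {0, 4}.
        R_at x = R \<or> R_at x = twist R)"


subsection \<open>Local isomorphism\<close>

fun lattice_box :: "point \<Rightarrow> nat \<Rightarrow> point set" where
  "lattice_box (x1, x2, x3) h =
     {(y1, y2, y3). \<bar>y1 - x1\<bar> \<le> int h \<and> \<bar>y2 - x2\<bar> \<le> int h \<and> \<bar>y3 - x3\<bar> \<le> int h}"

type_synonym pattern = "segment set \<times> (segment \<times> segment) set"

definition restrict_box :: "curve set \<Rightarrow> point \<Rightarrow> nat \<Rightarrow> pattern" where
  "restrict_box F x h =
     ({s \<in> \<Union> (segs_of ` F). s \<subseteq> lattice_box x h},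
      {(s, t) \<in> connexions F. s \<subseteq> lattice_box x h \<and> t \<subseteq> lattice_box x h})"

definition translate :: "point \<Rightarrow> pattern \<Rightarrow> pattern" where
  "translate w = map_prod (image (image ((+) w)))
                          (image (map_prod (image ((+) w)) (image ((+) w))))"

definition translation_equiv :: "pattern \<Rightarrow> pattern \<Rightarrow> bool" where
  "translation_equiv p q \<longleftrightarrow> (\<exists>w. translate w p = q)"

definition locally_isomorphic :: "curve set \<Rightarrow> curve set \<Rightarrow> bool" where
  "locally_isomorphic F G \<longleftrightarrow>
     (\<forall>h\<ge>1. \<forall>x. \<exists>y. translation_equiv (restrict_box F x h) (restrict_box G y h)) \<and>
     (\<forall>h\<ge>1. \<forall>y. \<exists>x. translation_equiv (restrict_box F x h) (restrict_box G y h))"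

end

theory Submission
  imports Defs
begin

text \<open>Orient the segments. Replacing every oriented segment by its curve of \<open>\<C>\<close> is a bijection
  from pairs of a step and a digit in \<open>{0..<8}\<close> onto steps, commuting with reversal and carrying
  translations by \<open>2 w\<close> to translations by \<open>4 w\<close>. Hence a connexion of \<open>\<C>\<^sup>n\<close> persists under
  translations by high powers of 2, and the connexions at \<open>2 p\<close>, for \<open>p\<close> with even coordinates, are
  those at \<open>p\<close> conjugated by \<open>\<theta>\<close>. If \<open>R\<close> satisfies (P), the connexions around \<open>0\<close> in the
  completed limit therefore reappear around \<open>2\<^sup>k x\<close> for suitable \<open>x\<close> and large \<open>k\<close>, so that all
  finite patterns already occur in the limit away from \<open>0\<close>.

  The single curve is an increasing union of translates of the curves of \<open>\<C>\<^sup>3\<^sup>n\<close> obtained from one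
  segment, which sits inside its own third refinement up to a translation. Taking threefold parents
  contracts distances by 8, so that every segment ends up in a finite region, where a computation
  shows that it descends from the chosen segment; thus the union contains every segment. Its finite
  patterns come from \<open>\<C>\<^sup>3\<^sup>n\<close>, and conversely each pattern of the limit is repeated periodically and
  so is met by any sufficiently large box.\<close>

section \<open>The substitution on oriented segments\<close>

text \<open>The curves of C are listed from their ends 2 p with p of even coordinate sum, so a step
  starting at an odd point runs through its curve backwards; and the isometry that places a curve
  depends on p modulo 2. Hence the substitution commutes with translations by even vectors only.
  This reduces the properties of C to 24 steps, but it also explains why \<open>drift\<close> has to
  be even: the nested refinements must fit together.

  The origin is special because doubling fixes it. At any other point, passing to parents halves the
  point until the connexion lies in the interior of a curve of C; at 0 this descent never stops, so
  a pairing has to be supplied. Since \<theta> is an involution, the parity of the number of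
  doublings decides which of R and its conjugate is seen; this is why (P) offers both.

  The contraction is only approximate: three parents accumulate an error of 2 + 4 + 8 = 14 per
  coordinate, and this determines the finite region.\<close>

type_synonym step = "point \<times> point"

definition steps :: "step set" where
  "steps = UNIV \<times> directions"

definition head :: "step \<Rightarrow> point" where
  "head x = fst x + snd x"

definition flip :: "step \<Rightarrow> step" where
  "flip x = (fst x + snd x, - snd x)"

definition shift :: "point \<Rightarrow> step \<Rightarrow> step" where
  "shift w x = (fst x + w, snd x)"

definition seg :: "step \<Rightarrow> segment" where
  "seg x = {fst x, head x}"

fun even_point :: "point \<Rightarrow> bool" where
  "even_point (a, b, c) \<longleftrightarrow> (a + b + c) mod 2 = 0"

text \<open>The linear parts of the isometries that carry \<open>\<B>\<^sub>0\<close> to the curves of \<open>\<C>\<close> starting at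
  \<open>2 p\<close>, for \<open>p\<close> with even coordinate sum.\<close>
fun twirl :: "point \<Rightarrow> point \<Rightarrow> point" where
  "twirl (a, b, c) (x, y, z) =
     (if c mod 2 = 0 then x else - x, if a mod 2 = 0 then y else - y, if b mod 2 = 0 then z else - z)"

definition root_curve :: "point \<Rightarrow> point list" where
  "root_curve d =
     (if d = (1,0,0) then
        [(0,0,0), (0,-1,0), (0,-1,-1), (0,0,-1), (1,0,-1), (1,-1,-1), (1,-1,0), (1,0,0), (2,0,0)]
      else if d = (-1,0,0) then
        [(0,0,0), (0,0,1), (0,1,1), (0,1,0), (-1,1,0), (-1,1,1), (-1,0,1), (-1,0,0), (-2,0,0)]
      else if d = (0,1,0) then
        [(0,0,0), (0,0,-1), (-1,0,-1), (-1,0,0), (-1,1,0), (-1,1,-1), (0,1,-1), (0,1,0), (0,2,0)]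
      else if d = (0,-1,0) then
        [(0,0,0), (1,0,0), (1,0,1), (0,0,1), (0,-1,1), (1,-1,1), (1,-1,0), (0,-1,0), (0,-2,0)]
      else if d = (0,0,1) then
        [(0,0,0), (-1,0,0), (-1,-1,0), (0,-1,0), (0,-1,1), (-1,-1,1), (-1,0,1), (0,0,1), (0,0,2)]
      else
        [(0,0,0), (0,1,0), (1,1,0), (1,0,0), (1,0,-1), (1,1,-1), (0,1,-1), (0,0,-1), (0,0,-2)])"

definition even_curve :: "step \<Rightarrow> point list" where
  "even_curve y = map (\<lambda>v. scale 2 (fst y) + twirl (fst y) v) (root_curve (twirl (fst y) (snd y)))"

text \<open>Every segment has exactly one end of even coordinate sum; reading the curve from there
  makes the substitution compatible with reversal.\<close>

definition curve_of :: "step \<Rightarrow> point list" where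
  "curve_of y = (if even_point (fst y) then even_curve y else rev (even_curve (flip y)))"

definition sub :: "step \<Rightarrow> int \<Rightarrow> step" where
  "sub y j = (curve_of y ! nat j, curve_of y ! nat (j + 1) - curve_of y ! nat j)"

definition dirs :: "point list" where
  "dirs = [(1,0,0), (-1,0,0), (0,1,0), (0,-1,0), (0,0,1), (0,0,-1)]"

definition dir_index :: "point \<Rightarrow> nat" where
  "dir_index d = (if d = (1,0,0) then 0 else if d = (-1,0,0) then 1 else if d = (0,1,0) then 2
     else if d = (0,-1,0) then 3 else if d = (0,0,1) then 4 else 5)"

text \<open>The inverse of \<open>sub\<close> at the steps \<open>((a, b, c), d)\<close> with \<open>a + b + c\<close> even and \<open>0 \<le> a, b, c < 4\<close>,
  where \<open>d\<close> runs through \<open>dirs\<close>; the rows are only used for such triples.\<close>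

definition parent_row :: "int \<Rightarrow> int \<Rightarrow> int \<Rightarrow> (step \<times> int) list" where
  "parent_row a b c = (
    if a = 0 then
      (if b = 0 then
       (if c = 0 then
        [(((0,0,0),(0,-1,0)),0), (((0,0,0),(0,0,1)),0), (((0,0,0),(0,0,-1)),0),
         (((0,0,0),(1,0,0)),0), (((0,0,0),(-1,0,0)),0), (((0,0,0),(0,1,0)),0)]
        else
        [(((0,0,1),(1,0,0)),0), (((0,0,1),(-1,0,0)),0), (((0,0,1),(0,1,0)),0),
         (((0,0,1),(0,-1,0)),0), (((0,0,1),(0,0,1)),0), (((0,0,1),(0,0,-1)),0)])
      else if b = 1 then
       (if c = 1 then
        [(((0,1,1),(0,0,-1)),4), (((0,1,1),(0,-1,0)),4), (((0,0,1),(0,1,0)),4),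
         (((-1,0,0),(1,0,0)),6), (((0,1,0),(0,0,1)),4), (((0,0,0),(-1,0,0)),2)]
        else
        [(((0,0,1),(0,0,1)),2), (((0,1,2),(0,-1,0)),2), (((0,1,1),(-1,0,0)),2),
         (((0,0,2),(0,0,-1)),6), (((0,0,2),(0,1,0)),6), (((-1,1,1),(1,0,0)),6)])
      else if b = 2 then
       (if c = 0 then
        [(((0,1,0),(1,0,0)),0), (((0,1,0),(-1,0,0)),0), (((0,1,0),(0,1,0)),0),
         (((0,1,0),(0,-1,0)),0), (((0,1,0),(0,0,1)),0), (((0,1,0),(0,0,-1)),0)]
        else
        [(((0,1,1),(0,0,-1)),0), (((0,1,1),(0,-1,0)),0), (((0,1,1),(0,0,1)),0),
         (((0,1,1),(-1,0,0)),0), (((0,1,1),(0,1,0)),0), (((0,1,1),(1,0,0)),0)])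
      else
       (if c = 1 then
        [(((0,2,0),(0,-1,0)),4), (((0,2,0),(0,0,1)),4), (((0,1,0),(0,1,0)),4),
         (((1,1,1),(-1,0,0)),6), (((0,1,1),(1,0,0)),2), (((0,2,1),(0,0,-1)),4)]
        else
        [(((0,2,1),(0,-1,0)),2), (((0,1,2),(0,0,-1)),2), (((0,2,2),(1,0,0)),2),
         (((0,1,1),(0,0,1)),6), (((1,2,2),(-1,0,0)),6), (((0,1,1),(0,1,0)),6)]))
    else if a = 1 then
      (if b = 0 then
       (if c = 1 then
        [(((0,0,1),(1,0,0)),4), (((0,0,0),(0,-1,0)),2), (((1,0,1),(-1,0,0)),4),
         (((1,0,1),(0,0,-1)),4), (((1,0,0),(0,0,1)),4), (((0,-1,0),(0,1,0)),6)]
        else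
        [(((1,0,1),(0,1,0)),2), (((1,0,2),(-1,0,0)),4), (((0,0,2),(0,0,-1)),4),
         (((0,0,2),(1,0,0)),4), (((0,0,1),(0,0,1)),4), (((1,1,1),(0,-1,0)),6)])
      else if b = 1 then
       (if c = 0 then
        [(((0,1,0),(1,0,0)),4), (((0,0,-1),(0,0,1)),6), (((1,0,0),(0,1,0)),4),
         (((0,0,0),(0,0,-1)),2), (((1,1,0),(0,-1,0)),4), (((1,1,0),(-1,0,0)),4)]
        else
        [(((1,0,1),(0,1,0)),6), (((0,1,1),(0,0,-1)),2), (((0,1,0),(0,0,1)),6),
         (((1,0,1),(-1,0,0)),6), (((1,1,1),(0,-1,0)),2), (((0,0,1),(1,0,0)),2)])
      else if b = 2 then
       (if c = 1 then
        [(((1,0,0),(0,1,0)),6), (((0,1,1),(0,0,-1)),6), (((1,1,1),(-1,0,0)),2),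
         (((0,1,0),(0,0,1)),2), (((0,1,1),(1,0,0)),6), (((1,1,0),(0,-1,0)),2)]
        else
        [(((1,1,2),(0,0,-1)),6), (((0,2,1),(0,-1,0)),6), (((1,1,1),(0,0,1)),2),
         (((0,1,2),(1,0,0)),2), (((1,1,2),(-1,0,0)),6), (((0,1,1),(0,1,0)),2)])
      else
       (if c = 0 then
        [(((1,1,0),(0,0,-1)),2), (((0,2,0),(0,-1,0)),6), (((0,2,0),(1,0,0)),6),
         (((1,1,-1),(0,0,1)),6), (((0,1,0),(0,1,0)),2), (((1,2,0),(-1,0,0)),2)]
        else
        [(((1,2,0),(0,0,1)),6), (((1,1,1),(-1,0,0)),4), (((1,2,1),(0,0,-1)),2),
         (((0,2,1),(0,-1,0)),4), (((0,1,1),(0,1,0)),4), (((0,1,1),(1,0,0)),4)]))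
    else if a = 2 then
      (if b = 0 then
       (if c = 0 then
        [(((1,0,0),(1,0,0)),0), (((1,0,0),(-1,0,0)),0), (((1,0,0),(0,1,0)),0),
         (((1,0,0),(0,-1,0)),0), (((1,0,0),(0,0,1)),0), (((1,0,0),(0,0,-1)),0)]
        else
        [(((1,0,1),(0,0,1)),0), (((1,0,1),(0,1,0)),0), (((1,0,1),(-1,0,0)),0),
         (((1,0,1),(0,0,-1)),0), (((1,0,1),(1,0,0)),0), (((1,0,1),(0,-1,0)),0)])
      else if b = 1 then
       (if c = 1 then
        [(((1,1,1),(0,0,-1)),2), (((1,0,0),(0,1,0)),2), (((1,1,0),(0,0,1)),6),
         (((1,0,1),(-1,0,0)),2), (((0,0,1),(1,0,0)),6), (((1,1,0),(0,-1,0)),6)]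
        else
        [(((1,0,1),(0,0,1)),4), (((1,0,1),(0,1,0)),4), (((0,1,2),(1,0,0)),6),
         (((1,1,1),(0,-1,0)),4), (((1,1,2),(-1,0,0)),2), (((1,0,2),(0,0,-1)),4)])
      else if b = 2 then
       (if c = 0 then
        [(((1,1,0),(0,1,0)),0), (((1,1,0),(0,0,-1)),0), (((1,1,0),(1,0,0)),0),
         (((1,1,0),(0,0,1)),0), (((1,1,0),(0,-1,0)),0), (((1,1,0),(-1,0,0)),0)]
        else
        [(((1,1,1),(1,0,0)),0), (((1,1,1),(-1,0,0)),0), (((1,1,1),(0,1,0)),0),
         (((1,1,1),(0,-1,0)),0), (((1,1,1),(0,0,1)),0), (((1,1,1),(0,0,-1)),0)])
      else
       (if c = 1 then
        [(((1,1,1),(0,1,0)),2), (((1,2,0),(0,0,1)),2), (((1,2,1),(0,0,-1)),6),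
         (((1,1,0),(1,0,0)),2), (((1,2,1),(0,-1,0)),6), (((2,1,0),(-1,0,0)),6)]
        else
        [(((1,1,2),(0,1,0)),4), (((1,1,2),(0,0,-1)),4), (((2,2,1),(-1,0,0)),6),
         (((1,2,2),(0,-1,0)),4), (((1,1,1),(0,0,1)),4), (((1,2,1),(1,0,0)),2)]))
    else
      (if b = 0 then
       (if c = 1 then
        [(((2,0,0),(0,0,1)),6), (((1,-1,1),(0,1,0)),6), (((1,0,0),(1,0,0)),2),
         (((2,0,1),(0,0,-1)),2), (((1,0,1),(0,-1,0)),2), (((2,0,0),(-1,0,0)),6)]
        else
        [(((2,1,2),(0,-1,0)),6), (((1,0,1),(0,0,1)),6), (((1,0,2),(0,0,-1)),2),
         (((2,0,1),(-1,0,0)),2), (((2,0,2),(0,1,0)),2), (((1,0,1),(1,0,0)),6)])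
      else if b = 1 then
       (if c = 0 then
        [(((1,0,0),(1,0,0)),4), (((1,1,1),(0,0,-1)),6), (((1,1,0),(0,0,1)),2),
         (((2,1,0),(0,-1,0)),4), (((2,0,0),(-1,0,0)),4), (((2,0,0),(0,1,0)),4)]
        else
        [(((2,1,1),(0,-1,0)),6), (((1,0,1),(0,0,1)),2), (((2,1,1),(-1,0,0)),6),
         (((1,0,2),(0,0,-1)),6), (((1,1,1),(1,0,0)),2), (((2,0,1),(0,1,0)),2)])
      else if b = 2 then
       (if c = 1 then
        [(((2,1,1),(0,-1,0)),2), (((2,1,0),(-1,0,0)),4), (((1,1,0),(1,0,0)),4),
         (((1,1,0),(0,0,1)),4), (((2,0,1),(0,1,0)),6), (((1,1,1),(0,0,-1)),4)]
        else
        [(((1,1,1),(1,0,0)),4), (((1,1,2),(0,1,0)),2), (((2,1,1),(0,0,1)),4),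
         (((2,1,1),(-1,0,0)),4), (((1,2,2),(0,-1,0)),6), (((2,1,2),(0,0,-1)),4)])
      else
       (if c = 0 then
        [(((2,2,0),(0,0,1)),2), (((1,1,0),(0,1,0)),6), (((2,2,1),(0,0,-1)),6),
         (((1,1,0),(1,0,0)),6), (((2,1,0),(-1,0,0)),2), (((1,2,0),(0,-1,0)),2)]
        else
        [(((2,1,2),(0,0,-1)),6), (((2,2,1),(-1,0,0)),4), (((1,1,1),(0,1,0)),4),
         (((2,1,1),(0,0,1)),2), (((1,2,1),(1,0,0)),4), (((1,2,1),(0,-1,0)),4)])))"

fun even_parent :: "step \<Rightarrow> step \<times> int" where
  "even_parent ((a, b, c), d) =
     map_prod (shift (2 * (a div 4), 2 * (b div 4), 2 * (c div 4))) id
       (parent_row (a mod 4) (b mod 4) (c mod 4) ! dir_index d)"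

definition parent :: "step \<Rightarrow> step \<times> int" where
  "parent x = (if even_point (fst x) then even_parent x
     else map_prod flip ((-) 7) (even_parent (flip x)))"

section \<open>Finite checks by evaluation\<close>

lemma directions_dirs: "directions = set dirs"
  by (auto simp: directions_def dirs_def e1_def e2_def e3_def)

definition points_in :: "int list \<Rightarrow> int list \<Rightarrow> int list \<Rightarrow> point list" where
  "points_in as bs cs = List.product as (List.product bs cs)"

fun parent_sub_ok :: "step \<times> int \<Rightarrow> bool" where
  "parent_sub_ok (y, j) \<longleftrightarrow> (even_point (fst y) \<longrightarrow>
     parent (sub y j) = (y, j) \<and> snd (sub y j) \<in> set dirs)"

fun near :: "point \<Rightarrow> point \<Rightarrow> bool" where
  "near (a, b, c) (a', b', c') \<longleftrightarrow> \<bar>a - 2 * a'\<bar> \<le> 2 \<and> \<bar>b - 2 * b'\<bar> \<le> 2 \<and> \<bar>c - 2 * c'\<bar> \<le> 2"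

fun doubled :: "point \<Rightarrow> bool" where
  "doubled (a, b, c) \<longleftrightarrow> a mod 2 = 0 \<and> b mod 2 = 0 \<and> c mod 2 = 0"

text \<open>The clause on \<open>near\<close> is the source of the contraction by parents. The last
  clause keeps interior vertices away from the points where curves of C meet; in the limit it
  excludes a connexion at 0.\<close>

definition curve_ok :: "step \<Rightarrow> bool" where
  "curve_ok y \<longleftrightarrow> (even_point (fst y) \<longrightarrow>
     length (even_curve y) = 9 \<and>
     even_curve y ! 0 = scale 2 (fst y) \<and> even_curve y ! 8 = scale 2 (head y) \<and>
     list_all (\<lambda>v. near v (fst y) \<and> near v (head y)) (even_curve y) \<and>
     list_all (\<lambda>v. \<not> doubled v) (butlast (tl (even_curve y))))"

lemma curve_check: "list_all curve_ok (List.product (points_in [0,1] [0,1] [0,1]) dirs)"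
  by code_simp


text \<open>With \<open>sub_parent_check\<close> this makes \<open>parent\<close> a two-sided
  inverse of \<open>sub\<close>: injectivity says that the curves of C are self-avoiding and
  disjoint, surjectivity that they cover.\<close>

lemma parent_sub_check:
  "list_all parent_sub_ok
     (List.product (List.product (points_in [0,1] [0,1] [0,1]) dirs) [0,1,2,3,4,5,6,7])"
  by code_simp

fun sub_parent_ok :: "step \<Rightarrow> bool" where
  "sub_parent_ok x \<longleftrightarrow> (even_point (fst x) \<longrightarrow>
     (case parent x of (y, j) \<Rightarrow> sub y j = x \<and> 0 \<le> j \<and> j < 8 \<and> snd y \<in> set dirs))"

lemma sub_parent_check:
  "list_all sub_parent_ok
     (List.product (points_in [0,1,2,3] [0,1,2,3] [0,1,2,3]) dirs)"
  by code_simp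

text \<open>Found by search: \<open>root\<close>, translated by the vector \<open>drift\<close> with even coordinates, is one
  of the 512 steps of the third refinement of \<open>root\<close>, in a position so central that refining
  \<open>root\<close> again and again exhausts all segments.\<close>

definition root :: step where
  "root = ((1,0,0), (0,-1,0))"

definition drift :: point where
  "drift = (10,-4,-2)"

text \<open>Undoes one round of refining three times and translating by \<open>- drift\<close>, the
  operation under which the final curve is invariant.\<close>

definition ancestor :: "step \<Rightarrow> step" where
  "ancestor x = fst (parent (fst (parent (fst (parent (shift drift x))))))"

definition descent_ok :: "step \<Rightarrow> bool" where
  "descent_ok x \<longleftrightarrow> ancestor (ancestor (ancestor x)) \<in> set [root, flip root]"

text \<open>The box consists of the points of \<open>spread\<close> at most 14, where the
  contraction need not make progress any more.\<close>

lemma descent_check: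
  "list_all descent_ok (List.product (points_in [0,1,2,3] [-2,-1,0,1] [-2,-1,0,1]) dirs)"
  by code_simp

section \<open>Reversal, translation and parity of steps\<close>

lemma flip_flip [simp]: "flip (flip x) = x"
  by (simp add: flip_def)

lemma head_flip [simp]: "head (flip x) = fst x"
  by (simp add: flip_def head_def)

lemma fst_flip [simp]: "fst (flip x) = head x"
  by (simp add: flip_def head_def)

lemma seg_flip [simp]: "seg (flip x) = seg x"
  by (auto simp: seg_def)

lemma fst_shift [simp]: "fst (shift w x) = fst x + w"
  by (simp add: shift_def)

lemma snd_shift [simp]: "snd (shift w x) = snd x"
  by (simp add: shift_def)

lemma head_shift [simp]: "head (shift w x) = head x + w"
  by (simp add: shift_def head_def)

lemma flip_shift: "flip (shift w x) = shift w (flip x)"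
  by (simp add: shift_def flip_def)

lemma shift_shift [simp]: "shift v (shift w x) = shift (v + w) x"
  by (simp add: shift_def)

lemma shift_0 [simp]: "shift 0 x = x"
  by (simp add: shift_def)

lemma seg_shift: "seg (shift w x) = (+) w ` seg x"
  by (simp add: seg_def add.commute)

lemma step_pair_simps [simp]:
  "head (p, d) = p + d" "flip (p, d) = (p + d, - d)" "shift w (p, d) = (p + w, d)"
  by (simp_all add: head_def flip_def shift_def)

lemma step_eqI: "fst x = fst y \<Longrightarrow> head x = head y \<Longrightarrow> x = y"
  by (simp add: head_def prod_eq_iff)

lemma seg_eq_iff: "seg x = seg y \<longleftrightarrow> x = y \<or> x = flip y"
  by (auto simp: seg_def doubleton_eq_iff intro: step_eqI)

lemma uminus_directions [simp]: "- d \<in> directions \<longleftrightarrow> d \<in> directions"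
proof -
  have "- d \<in> directions" if "d \<in> directions" for d
    using that by (auto simp: directions_def)
  from this[of d] this[of "- d"] show ?thesis by auto
qed

lemma zero_notin_directions: "0 \<notin> directions"
  by (simp add: directions_def e1_def e2_def e3_def zero_prod_def)

lemma flip_steps [simp]: "flip x \<in> steps \<longleftrightarrow> x \<in> steps"
  by (simp add: steps_def flip_def mem_Times_iff)

lemma shift_steps [simp]: "shift w x \<in> steps \<longleftrightarrow> x \<in> steps"
  by (simp add: steps_def mem_Times_iff)

lemma fst_neq_head: "x \<in> steps \<Longrightarrow> fst x \<noteq> head x"
  using zero_notin_directions by (auto simp: steps_def head_def)

lemma flip_neq: "x \<in> steps \<Longrightarrow> flip x \<noteq> x"
  using fst_neq_head by (metis fst_flip)

lemma segments_eq: "segments = seg ` steps"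
proof
  show "segments \<subseteq> seg ` steps"
  proof
    fix s assume "s \<in> segments"
    then obtain x e where "s = {x, x + e}" "e \<in> {e1, e2, e3}" by (auto simp: segments_def)
    then have "s = seg (x, e)" "(x, e) \<in> steps" by (auto simp: steps_def directions_def seg_def head_def)
    then show "s \<in> seg ` steps" by blast
  qed
  show "seg ` steps \<subseteq> segments"
  proof
    fix s assume "s \<in> seg ` steps"
    then obtain x where x: "x \<in> steps" "s = seg x" by blast
    have *: "seg y \<in> segments" if "snd y \<in> {e1, e2, e3}" for y
      using that unfolding seg_def head_def segments_def by blast
    have "snd x \<in> {e1, e2, e3} \<or> - snd x \<in> {e1, e2, e3}"
      using x by (auto simp: steps_def directions_def)
    then show "s \<in> segments" using *[of x] *[of "flip x"] x(2) by (simp only: seg_flip) (auto simp: flip_def)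
  qed
qed

lemma scale_1 [simp]: "scale 1 p = p"
  by (cases p) simp

lemma scale_scale [simp]: "scale a (scale b p) = scale (a * b) p"
  by (cases p) simp

lemma scale_add: "scale a (p + q) = scale a p + scale a q"
  by (cases p; cases q) (simp add: algebra_simps)

lemma scale_minus: "scale a (- p) = - scale a p"
  by (cases p) simp

lemma scale_0_right [simp]: "scale a 0 = 0"
  by (simp add: zero_prod_def)

lemma scale_eq_iff: "a \<noteq> 0 \<Longrightarrow> scale a p = scale a q \<longleftrightarrow> p = q"
  by (cases p; cases q) simp

lemma even_point_directions: "d \<in> directions \<Longrightarrow> even_point (p + d) \<longleftrightarrow> \<not> even_point p"
  by (cases p) (auto simp: directions_def e1_def e2_def e3_def; presburger)

lemma even_point_shift [simp]: "even_point (p + scale 2 w) \<longleftrightarrow> even_point p"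
  by (cases p; cases w) (simp; presburger)

lemma curve_of_flip:
  assumes "y \<in> steps" shows "curve_of (flip y) = rev (curve_of y)"
  using assms even_point_directions[of "snd y" "fst y"]
  by (auto simp: curve_of_def steps_def head_def)

lemma twirl_shift [simp]: "twirl (p + scale 2 w) = twirl p"
  by (cases p; cases w) (auto simp: fun_eq_iff)

lemma even_curve_shift:
  "even_curve (shift (scale 2 w) y) = map ((+) (scale 4 w)) (even_curve y)"
  by (simp add: even_curve_def scale_add algebra_simps)

lemma curve_of_shift:
  "curve_of (shift (scale 2 w) y) = map ((+) (scale 4 w)) (curve_of y)"
  by (simp add: curve_of_def even_curve_shift flip_shift rev_map)

section \<open>Transfer of the finite checks to all steps\<close>

lemma int_ranges: "{0..<2} = set [0, 1 :: int]" "{0..<4} = set [0, 1, 2, 3 :: int]"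
  by auto

lemma reduce_mod:
  assumes "m > 0"
  obtains w :: point and a b c :: int where "p = (a, b, c) + scale m w" "a \<in> {0..<m}" "b \<in> {0..<m}" "c \<in> {0..<m}"
proof -
  obtain x y z where p: "p = (x, y, z)" by (cases p) auto
  show ?thesis
    by (rule that[of "x mod m" "y mod m" "z mod m" "(x div m, y div m, z div m)"]) (use assms in \<open>auto simp: p\<close>)
qed

lemma step_mod_2:
  assumes "y \<in> steps"
  obtains w z where "y = shift (scale 2 w) z"
    "z \<in> set (List.product (points_in [0,1] [0,1] [0,1]) dirs)"
proof -
  obtain p d where y: "y = (p, d)" by (rule prod.exhaust)
  obtain w a b c where p: "p = (a, b, c) + scale 2 w" "a \<in> {0..<2}" "b \<in> {0..<2}" "c \<in> {0..<2}"
    by (rule reduce_mod[of 2 p]) auto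
  show ?thesis
    by (rule that[of w "((a, b, c), d)"])
      (use p assms in \<open>simp_all only: y points_in_def steps_def directions_dirs int_ranges set_product
        mem_Times_iff fst_conv snd_conv step_pair_simps simp_thms\<close>)
qed

text \<open>The modulus is 4 because \<open>sub\<close> turns translations by 2 w into translations
  by 4 w, so its inverse has to be checked on a period of length 4.\<close>

lemma step_mod_4:
  assumes "y \<in> steps"
  obtains w z where "y = shift (scale 4 w) z"
    "z \<in> set (List.product (points_in [0,1,2,3] [0,1,2,3] [0,1,2,3]) dirs)"
proof -
  obtain p d where y: "y = (p, d)" by (rule prod.exhaust)
  obtain w a b c where p: "p = (a, b, c) + scale 4 w" "a \<in> {0..<4}" "b \<in> {0..<4}" "c \<in> {0..<4}"
    by (rule reduce_mod[of 4 p]) auto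
  show ?thesis
    by (rule that[of w "((a, b, c), d)"])
      (use p assms in \<open>simp_all only: y points_in_def steps_def directions_dirs int_ranges set_product
        mem_Times_iff fst_conv snd_conv step_pair_simps simp_thms\<close>)
qed

lemma even_parent_shift:
  "even_parent (shift (scale 4 w) x) = map_prod (shift (scale 2 w)) id (even_parent x)"
proof -
  obtain a b c d where x: "x = ((a, b, c), d)" by (metis prod.exhaust)
  obtain u v t where w: "w = (u, v, t)" by (metis prod.exhaust)
  show ?thesis
    by (simp add: x w prod.map_comp comp_def algebra_simps id_def)
qed

lemma parent_shift:
  "parent (shift (scale 4 w) x) = map_prod (shift (scale 2 w)) id (parent x)"
  using even_point_shift[of "fst x" "scale 2 w"]
  by (auto simp: parent_def even_parent_shift flip_shift prod.map_comp comp_def)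

lemma parent_flip:
  assumes "x \<in> steps" shows "parent (flip x) = map_prod flip ((-) 7) (parent x)"
proof -
  have "map_prod flip ((-) 7) (map_prod flip ((-) 7) u) = u" for u :: "step \<times> int"
    by (cases u) simp
  moreover have "even_point (head x) \<longleftrightarrow> \<not> even_point (fst x)"
    using assms even_point_directions[of "snd x" "fst x"] by (auto simp: steps_def head_def)
  ultimately show ?thesis by (simp add: parent_def)
qed

lemma curve_ok:
  assumes "y \<in> steps" "even_point (fst y)"
  shows "length (even_curve y) = 9" "even_curve y ! 0 = scale 2 (fst y)" "even_curve y ! 8 = scale 2 (head y)"
    "list_all (\<lambda>v. near v (fst y) \<and> near v (head y)) (even_curve y)"
    "list_all (\<lambda>v. \<not> doubled v) (butlast (tl (even_curve y)))"
proof -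
  obtain w z where y: "y = shift (scale 2 w) z"
    and z: "z \<in> set (List.product (points_in [0,1] [0,1] [0,1]) dirs)"
    using step_mod_2[OF assms(1)] by blast
  have "curve_ok z" using curve_check z by (simp only: list_all_iff)
  moreover have "even_point (fst z)" using assms(2) by (simp add: y)
  ultimately have *: "length (even_curve z) = 9" "even_curve z ! 0 = scale 2 (fst z)" "even_curve z ! 8 = scale 2 (head z)"
    "list_all (\<lambda>v. near v (fst z) \<and> near v (head z)) (even_curve z)"
    "list_all (\<lambda>v. \<not> doubled v) (butlast (tl (even_curve z)))"
    by (auto simp: curve_ok_def)
  show "length (even_curve y) = 9" "even_curve y ! 0 = scale 2 (fst y)" "even_curve y ! 8 = scale 2 (head y)"
    using *(1-3) by (auto simp: y even_curve_shift scale_add)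
  have n: "near (scale 4 w + v) (u + scale 2 w) = near v u" for u v
    by (cases u; cases v; cases w) simp
  have d: "doubled (scale 4 w + v) = doubled v" for v
    by (cases v; cases w) (simp; presburger)
  show "list_all (\<lambda>v. near v (fst y) \<and> near v (head y)) (even_curve y)"
    using *(4) by (simp add: y even_curve_shift list_all_iff n)
  show "list_all (\<lambda>v. \<not> doubled v) (butlast (tl (even_curve y)))"
    using *(5) by (simp add: y even_curve_shift list_all_iff d map_tl[symmetric] map_butlast[symmetric])
qed

text \<open>A case distinction in the form of an induction: one of \<open>y\<close> and
  \<open>flip y\<close> starts at an even point, so a property stable under reversal need only be
  proved there.\<close>

lemma steps_even_induct [consumes 1, case_names even odd]:
  assumes "y \<in> steps"
    and "\<And>y. y \<in> steps \<Longrightarrow> even_point (fst y) \<Longrightarrow> P y"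
    and "\<And>y. y \<in> steps \<Longrightarrow> P y \<Longrightarrow> P (flip y)"
  shows "P y"
proof (cases "even_point (fst y)")
  case False
  then have "even_point (fst (flip y))"
    using assms(1) even_point_directions[of "snd y" "fst y"] by (auto simp: steps_def head_def)
  then show ?thesis using assms(1) assms(2)[of "flip y"] assms(3)[of "flip y"] by simp
qed (use assms in auto)

lemma curve_of_even: "even_point (fst y) \<Longrightarrow> curve_of y = even_curve y"
  by (simp add: curve_of_def)

lemma length_curve_of [simp]: "y \<in> steps \<Longrightarrow> length (curve_of y) = 9"
  by (induction y rule: steps_even_induct) (auto simp: curve_of_even curve_ok curve_of_flip)

lemma curve_of_ends: "y \<in> steps \<Longrightarrow> curve_of y ! 0 = scale 2 (fst y) \<and> curve_of y ! 8 = scale 2 (head y)"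
  by (induction y rule: steps_even_induct) (auto simp: curve_of_even curve_ok curve_of_flip rev_nth)

lemma curve_of_near: "y \<in> steps \<Longrightarrow> v \<in> set (curve_of y) \<Longrightarrow> near v (fst y) \<and> near v (head y)"
  by (induction y rule: steps_even_induct)
    (use curve_ok(4) in \<open>auto simp: curve_of_even curve_of_flip list_all_iff\<close>)

lemma curve_of_not_doubled:
  assumes "y \<in> steps" "0 < k" "k < 8" shows "\<not> doubled (curve_of y ! k)"
  using assms
proof (induction y arbitrary: k rule: steps_even_induct)
  case (even y)
  have "even_curve y ! k = butlast (tl (even_curve y)) ! (k - 1)"
    using even curve_ok[of y] by (simp add: nth_butlast nth_tl)
  moreover have "k - 1 < length (butlast (tl (even_curve y)))"
    using even curve_ok[of y] by simp
  ultimately show ?case using curve_ok(5)[of y] even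
    by (metis curve_of_even list_all_length)
next
  case (odd y)
  then show ?case using odd.IH[of "8 - k"] by (auto simp: curve_of_flip rev_nth)
qed

lemma sub_flip:
  assumes "y \<in> steps" "0 \<le> j" "j < 8"
  shows "sub (flip y) j = flip (sub y (7 - j))"
proof -
  have "8 - nat j = nat (8 - j)" "8 - nat (j + 1) = nat (7 - j)" using assms by auto
  then show ?thesis
    using assms by (simp add: sub_def curve_of_flip rev_nth)
qed

lemma sub_shift:
  assumes "y \<in> steps" "0 \<le> j" "j < 8"
  shows "sub (shift (scale 2 w) y) j = shift (scale 4 w) (sub y j)"
  using assms by (simp add: sub_def curve_of_shift)

lemma fst_sub_0: "y \<in> steps \<Longrightarrow> fst (sub y 0) = scale 2 (fst y)"
  by (simp add: sub_def curve_of_ends)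

lemma head_sub_7: "y \<in> steps \<Longrightarrow> head (sub y 7) = scale 2 (head y)"
  by (simp add: sub_def curve_of_ends head_def)

lemma head_sub: "head (sub y j) = fst (sub y (j + 1))"
  by (simp add: sub_def)

lemma head_sub_not_doubled:
  "y \<in> steps \<Longrightarrow> 0 \<le> j \<Longrightarrow> j < 7 \<Longrightarrow> \<not> doubled (head (sub y j))"
  using curve_of_not_doubled[of y "nat (j + 1)"] by (simp add: sub_def)

lemma sub_near:
  "y \<in> steps \<Longrightarrow> 0 \<le> j \<Longrightarrow> j < 8 \<Longrightarrow> near (fst (sub y j)) (fst y)"
  using curve_of_near[of y "curve_of y ! nat j"] by (simp add: sub_def)

lemma parent_sub_steps:
  assumes "y \<in> steps" "0 \<le> j" "j < 8"
  shows "parent (sub y j) = (y, j) \<and> sub y j \<in> steps"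
  using assms
proof (induction y arbitrary: j rule: steps_even_induct)
  case (even y)
  obtain w z where y: "y = shift (scale 2 w) z"
    and z: "z \<in> set (List.product (points_in [0,1] [0,1] [0,1]) dirs)"
    using step_mod_2[OF even(1)] by blast
  have "j = 0 \<or> j = 1 \<or> j = 2 \<or> j = 3 \<or> j = 4 \<or> j = 5 \<or> j = 6 \<or> j = 7" using even(3,4) by arith
  then have "j \<in> set [0,1,2,3,4,5,6,7]" by auto
  then have "(z, j) \<in> set (List.product (List.product (points_in [0,1] [0,1] [0,1]) dirs) [0,1,2,3,4,5,6,7])"
    using z by (simp only: set_product mem_Times_iff fst_conv snd_conv simp_thms)
  then have "parent_sub_ok (z, j)" using parent_sub_check by (simp only: list_all_iff)
  then have "parent (sub z j) = (z, j)" "sub z j \<in> steps"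
    using even(2) unfolding y steps_def directions_dirs by (auto simp: mem_Times_iff)
  then show ?case using even(1,3,4) by (simp add: y sub_shift parent_shift)
next
  case (odd y)
  then have "parent (sub y (7 - j)) = (y, 7 - j)" "sub y (7 - j) \<in> steps" by auto
  with odd show ?case by (simp add: sub_flip parent_flip)
qed

lemma parent_sub: "y \<in> steps \<Longrightarrow> 0 \<le> j \<Longrightarrow> j < 8 \<Longrightarrow> parent (sub y j) = (y, j)"
  and sub_steps: "y \<in> steps \<Longrightarrow> 0 \<le> j \<Longrightarrow> j < 8 \<Longrightarrow> sub y j \<in> steps"
  using parent_sub_steps by blast+

lemma sub_parent:
  assumes "x \<in> steps" "parent x = (y, j)"
  shows "sub y j = x \<and> 0 \<le> j \<and> j < 8 \<and> y \<in> steps"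
  using assms
proof (induction x arbitrary: y j rule: steps_even_induct)
  case (even x)
  obtain w z where x: "x = shift (scale 4 w) z"
    and z: "z \<in> set (List.product (points_in [0,1,2,3] [0,1,2,3] [0,1,2,3]) dirs)"
    using step_mod_4[OF even(1)] by blast
  have "even_point (fst z)" using even(2) even_point_shift[of "fst z" "scale 2 w"] by (simp add: x)
  moreover have "sub_parent_ok z" using sub_parent_check z by (simp only: list_all_iff)
  moreover obtain u i where p: "parent z = (u, i)" by fastforce
  ultimately have "sub u i = z" "0 \<le> i" "i < 8" "u \<in> steps"
    by (auto simp: steps_def directions_dirs mem_Times_iff)
  moreover have "y = shift (scale 2 w) u" "i = j"
    using even(3) p by (simp_all add: x parent_shift)
  ultimately show ?case by (simp add: x sub_shift)
next
  case (odd x)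
  obtain u i where p: "parent x = (u, i)" by fastforce
  with odd.IH[OF p] odd.hyps odd.prems show ?case
    by (auto simp: parent_flip sub_flip)
qed

lemma sub_inject:
  assumes "y \<in> steps" "z \<in> steps" "0 \<le> i" "i < 8" "0 \<le> j" "j < 8"
  shows "sub y i = sub z j \<longleftrightarrow> y = z \<and> i = j"
  using assms parent_sub by (metis prod.inject)

lemma sub_surj:
  assumes "x \<in> steps"
  obtains y j where "x = sub y j" "y \<in> steps" "0 \<le> j" "j < 8"
  using sub_parent[OF assms] by (metis prod.exhaust)

lemma zero_point: "(0, 0, 0) = (0 :: point)"
  by (simp add: zero_prod_def)

text \<open>The origin of \<theta>: it gives the initial direction of the curve that replaces a
  segment leaving 0.\<close>

lemma sub_zero_theta:
  assumes "d \<in> directions"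
  shows "sub (0, d) 0 = (0, theta d)"
proof -
  have "list_all (\<lambda>d. sub ((0,0,0), d) 0 = ((0,0,0), theta d)) dirs"
    by (simp add: dirs_def sub_def curve_of_def even_curve_def root_curve_def theta_def e1_def e2_def e3_def
        zero_prod_def)
  then show ?thesis using assms by (simp add: directions_dirs list_all_iff zero_point)
qed

section \<open>Iterated substitution and the connexions of the limit\<close>

text \<open>Keeps quantifiers over points and steps from being split into coordinates.\<close>

declare split_paired_All [simp del] split_paired_Ex [simp del]

text \<open>The \<open>i\<close>-th step of the \<open>n\<close>-fold refinement of
  \<open>y\<close>. The base 8 digits of \<open>i\<close> choose the substeps, the most significant
  digit first.\<close>

fun pos :: "nat \<Rightarrow> step \<Rightarrow> int \<Rightarrow> step" where
  "pos 0 y i = y"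
| "pos (Suc n) y i = sub (pos n y (i div 8)) (i mod 8)"

lemma pos_steps: "y \<in> steps \<Longrightarrow> pos n y i \<in> steps"
  by (induction n arbitrary: i) (auto intro: sub_steps)

lemma pos_add: "pos (n + m) y i = pos n (pos m y (i div 8 ^ n)) (i mod 8 ^ n)"
proof (induction n arbitrary: i)
  case (Suc n)
  have "i mod 8 ^ Suc n = 8 * (i div 8 mod 8 ^ n) + i mod 8"
    by (simp add: zmod_zmult2_eq)
  then have "i mod 8 ^ Suc n div 8 = i div 8 mod 8 ^ n" "i mod 8 ^ Suc n mod 8 = i mod 8"
    by simp_all
  moreover have "i div 8 div 8 ^ n = i div 8 ^ Suc n"
    by (simp add: zdiv_zmult2_eq)
  ultimately show ?case by (simp add: Suc)
qed simp

lemma pos_flip: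
  assumes "y \<in> steps" shows "pos n (flip y) i = flip (pos n y (8 ^ n - 1 - i))"
proof (induction n arbitrary: i)
  case (Suc n)
  \<comment> \<open>Subtraction from 8 N - 1 complements the last digit without a borrow.\<close>
  have "8 * N - 1 - i = (7 - i mod 8) + (N - 1 - i div 8) * 8" for N :: int
    using mult_div_mod_eq[of 8 i] by (simp add: algebra_simps)
  moreover have "(7 - i mod 8) div 8 = 0" "(7 - i mod 8) mod 8 = 7 - i mod 8"
    by simp_all
  ultimately have "(8 * N - 1 - i) div 8 = N - 1 - i div 8" "(8 * N - 1 - i) mod 8 = 7 - i mod 8" for N :: int
    by (simp_all only: div_mult_self1 mod_mult_self1 zero_neq_numeral[symmetric] not_False_eq_True add_0)
  then show ?case
    using assms by (simp add: Suc sub_flip pos_steps)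
qed simp

lemma pos_shift:
  assumes "y \<in> steps"
  shows "pos n (shift (scale 2 w) y) i = shift (scale (2 ^ (n + 1)) w) (pos n y i)"
proof (induction n arbitrary: i)
  case (Suc n)
  have "pos (Suc n) (shift (scale 2 w) y) i
      = sub (shift (scale 2 (scale (2 ^ n) w)) (pos n y (i div 8))) (i mod 8)"
    by (simp add: Suc)
  also have "\<dots> = shift (scale 4 (scale (2 ^ n) w)) (sub (pos n y (i div 8)) (i mod 8))"
    using assms by (intro sub_shift) (simp_all add: pos_steps)
  finally show ?case by simp
qed simp

lemma fst_pos_0:
  assumes "y \<in> steps" shows "fst (pos n y 0) = scale (2 ^ n) (fst y)"
  using assms by (induction n) (simp_all add: fst_sub_0 pos_steps)

lemma div_8_bounds:
  "0 \<le> i \<Longrightarrow> i < 8 ^ Suc n \<Longrightarrow> 0 \<le> i div 8 \<and> i div 8 < (8 ^ n :: int)"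
  by auto

text \<open>Peeling off the last digit reduces this to injectivity of \<open>sub\<close>. The
  self-avoidance of the final curve comes from here.\<close>

lemma pos_inject:
  assumes "y \<in> steps" "z \<in> steps" "0 \<le> i" "i < 8 ^ n" "0 \<le> j" "j < 8 ^ n"
  shows "pos n y i = pos n z j \<longleftrightarrow> y = z \<and> i = j"
  using assms
proof (induction n arbitrary: i j)
  case (Suc n)
  have "pos (Suc n) y i = pos (Suc n) z j \<longleftrightarrow>
      pos n y (i div 8) = pos n z (j div 8) \<and> i mod 8 = j mod 8"
    using Suc.prems by (simp add: sub_inject pos_steps)
  also have "\<dots> \<longleftrightarrow> y = z \<and> i div 8 = j div 8 \<and> i mod 8 = j mod 8"
    using Suc.prems Suc.IH[of "i div 8" "j div 8"] div_8_bounds[of i n] div_8_bounds[of j n] by simp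
  also have "\<dots> \<longleftrightarrow> y = z \<and> i = j"
    by (metis mult_div_mod_eq)
  finally show ?case .
qed simp

text \<open>Consecutive steps of some power of C, described without levels or indices: a link is
  inside a curve of C or is induced by a link between the parents. \<open>follows_iff_pos\<close>
  gives the description by indices.\<close>

inductive follows :: "step \<Rightarrow> step \<Rightarrow> bool" where
  inside: "y \<in> steps \<Longrightarrow> 0 \<le> j \<Longrightarrow> j < 7 \<Longrightarrow> follows (sub y j) (sub y (j + 1))"
| across: "follows y z \<Longrightarrow> follows (sub y 7) (sub z 0)"

lemma doubled_scale [simp]: "doubled (scale 2 p)"
  by (cases p) simp

lemma doubledE:
  assumes "doubled p" obtains q where "p = scale 2 q"
proof -
  obtain a b c where "p = (a, b, c)" by (rule prod_cases3)
  with assms have "p = scale 2 (a div 2, b div 2, c div 2)" by auto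
  then show ?thesis by (rule that)
qed

lemma follows_steps: "follows x y \<Longrightarrow> x \<in> steps \<and> y \<in> steps"
  by (induction rule: follows.induct) (auto intro: sub_steps)

lemma follows_head: "follows x y \<Longrightarrow> fst y = head x"
  by (induction rule: follows.induct)
    (simp add: head_sub, metis head_sub_7 fst_sub_0 follows_steps)

lemma follows_flip: "follows x y \<Longrightarrow> follows (flip y) (flip x)"
proof (induction rule: follows.induct)
  case (inside y j)
  then show ?case
    using follows.inside[of "flip y" "6 - j"] by (simp add: sub_flip add.commute)
next
  case (across y z)
  then have "y \<in> steps" "z \<in> steps" using follows_steps by blast+
  then show ?case
    using follows.across[OF across.IH] by (simp add: sub_flip)
qed

lemma follows_not_flip: "follows x y \<Longrightarrow> y \<noteq> flip x"
proof (induction rule: follows.induct)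
  case (inside y j)
  then have "flip (sub y j) = sub (flip y) (7 - j)" by (simp add: sub_flip)
  then show ?case using inside flip_neq[of y] by (auto simp: sub_inject)
next
  case (across y z)
  then have "y \<in> steps" "z \<in> steps" using follows_steps by blast+
  then have "flip (sub y 7) = sub (flip y) 0" by (simp add: sub_flip)
  then show ?case using across \<open>y \<in> steps\<close> \<open>z \<in> steps\<close> by (auto simp: sub_inject)
qed

text \<open>Inversion of the rules: since \<open>sub\<close> is injective, the digit of a step
  decides which rule can have produced its link.\<close>

lemma follows_sub_iff:
  assumes "y \<in> steps" "0 \<le> j" "j < 8"
  shows "follows (sub y j) x \<longleftrightarrow>
    (if j < 7 then x = sub y (j + 1) else \<exists>z. follows y z \<and> x = sub z 0)"
proof
  assume "follows (sub y j) x"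
  then show "if j < 7 then x = sub y (j + 1) else \<exists>z. follows y z \<and> x = sub z 0"
  proof cases
    case (inside z i)
    then show ?thesis using assms by (auto simp: sub_inject)
  next
    case (across u z)
    then have "u \<in> steps" using follows_steps by blast
    then show ?thesis using assms across by (auto simp: sub_inject)
  qed
next
  assume r: "if j < 7 then x = sub y (j + 1) else \<exists>z. follows y z \<and> x = sub z 0"
  show "follows (sub y j) x"
  proof (cases "j < 7")
    case False
    then have "j = 7" using assms by simp
    then show ?thesis using r by (auto intro: follows.across)
  qed (use r assms in \<open>auto intro: follows.inside\<close>)
qed

lemma follows_unique: "follows x y \<Longrightarrow> follows x z \<Longrightarrow> y = z"
proof (induction arbitrary: z rule: follows.induct)
  case (inside y j)
  then show ?case by (simp add: follows_sub_iff)
next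
  case (across y w)
  then have "y \<in> steps" using follows_steps by blast
  then obtain u where "follows y u" "z = sub u 0"
    using across.prems by (subst (asm) follows_sub_iff) auto
  with across.IH show ?case by blast
qed

text \<open>A link at 0 could not be inside a curve, whose interior vertices are not doubled, so it
  would come from a link of the parents that is again at 0.\<close>

lemma follows_head_nonzero: "follows x y \<Longrightarrow> head x \<noteq> 0"
proof (induction rule: follows.induct)
  case (inside y j)
  then have "\<not> doubled (head (sub y j))" by (simp add: head_sub_not_doubled)
  moreover have "doubled 0" by (simp add: zero_prod_def)
  ultimately show ?case by metis
next
  case (across y z)
  then have "y \<in> steps" using follows_steps by blast
  with across show ?case using scale_eq_iff[of 2 "head y" 0] by (simp add: head_sub_7)
qed

definition norm1 :: "point \<Rightarrow> nat" where
  "norm1 p = nat (\<bar>fst p\<bar> + \<bar>fst (snd p)\<bar> + \<bar>snd (snd p)\<bar>)"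

lemma norm1_scale: "norm1 (scale 2 p) = 2 * norm1 p"
  by (cases p) (simp add: norm1_def)

lemma norm1_eq_0: "norm1 p = 0 \<longleftrightarrow> p = 0"
  by (cases p) (auto simp: norm1_def zero_prod_def)

text \<open>A digit below 7 is continued inside its curve. With digit 7 the head is twice that of
  the parent, so the parent has a strictly smaller head.\<close>

lemma follows_ex:
  assumes "x \<in> steps" "head x \<noteq> 0" shows "\<exists>y. follows x y"
  using assms
proof (induction "norm1 (head x)" arbitrary: x rule: less_induct)
  case less
  obtain y j where y: "x = sub y j" "y \<in> steps" "0 \<le> j" "j < 8"
    using sub_surj[OF less.prems(1)] by blast
  show ?case
  proof (cases "j < 7")
    case True
    then show ?thesis using y follows.inside by blast
  next
    case False
    then have j: "j = 7" using y by simp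
    then have h: "head x = scale 2 (head y)" using y by (simp add: head_sub_7)
    then have "head y \<noteq> 0" using less.prems by auto
    moreover have "norm1 (head y) < norm1 (head x)"
      using norm1_eq_0[of "head y"] \<open>head y \<noteq> 0\<close> by (simp add: h norm1_scale)
    ultimately obtain z where "follows y z" using less.hyps y by blast
    then show ?thesis using y j follows.across by blast
  qed
qed

text \<open>A link inside a curve survives translations by multiples of 4, and each use of
  \<open>across\<close> at most doubles the period.\<close>

lemma follows_periodic:
  "follows x y \<Longrightarrow> \<exists>N. \<forall>k\<ge>N. \<forall>w. follows (shift (scale (2 ^ k) w) x) (shift (scale (2 ^ k) w) y)"
proof (induction rule: follows.induct)
  case (inside y j)
  have "follows (shift (scale (2 ^ k) w) (sub y j)) (shift (scale (2 ^ k) w) (sub y (j + 1)))"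
    if "k \<ge> 2" for k w
  proof -
    define l where "l = k - 2"
    then have k: "k = l + 2" using \<open>k \<ge> 2\<close> by simp
    have s: "shift (scale (2 ^ k) w) (sub y i) = sub (shift (scale 2 (scale (2 ^ l) w)) y) i"
      if "0 \<le> i" "i < 8" for i
      using that inside sub_shift[of y i "scale (2 ^ l) w"] by (simp add: k)
    show ?thesis
      using inside by (simp add: s follows.inside)
  qed
  then show ?case by blast
next
  case (across y z)
  then have st: "y \<in> steps" "z \<in> steps" using follows_steps by blast+
  obtain N where N: "follows (shift (scale (2 ^ k) w) y) (shift (scale (2 ^ k) w) z)"
    if "k \<ge> N" for k w
    using across.IH by blast
  \<comment> \<open>The parents are translated by \<open>scale (2 ^ (k - 1)) w\<close> only; the
    bound \<open>N + 2\<close> leaves room for this and ensures that \<open>k\<close> is at least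
    2.\<close>
  have "follows (shift (scale (2 ^ k) w) (sub y 7)) (shift (scale (2 ^ k) w) (sub z 0))"
    if "k \<ge> N + 2" for k w
  proof -
    define l where "l = k - 2"
    then have k: "k = l + 2" and l: "l + 1 \<ge> N" using that by simp_all
    have s: "shift (scale (2 ^ k) w) (sub u i) = sub (shift (scale 2 (scale (2 ^ l) w)) u) i"
      if "0 \<le> i" "i < 8" "u \<in> steps" for u i
      using that sub_shift[of u i "scale (2 ^ l) w"] by (simp add: k)
    have "follows (shift (scale 2 (scale (2 ^ l) w)) y) (shift (scale 2 (scale (2 ^ l) w)) z)"
      using N[OF l, of w] by simp
    from follows.across[OF this] show ?thesis
      using s[of 7 y] s[of 0 z] st by simp
  qed
  then show ?case by blast
qed

lemma follows_pos:
  assumes "y \<in> steps" "0 \<le> i" "i + 1 < 8 ^ n"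
  shows "follows (pos n y i) (pos n y (i + 1))"
  using assms
proof (induction n arbitrary: i)
  case (Suc n)
  show ?case
  proof (cases "i mod 8 < 7")
    case True
    have "i + 1 = (i mod 8 + 1) + i div 8 * 8" by simp
    moreover have "(i mod 8 + 1) div 8 = 0" "(i mod 8 + 1) mod 8 = i mod 8 + 1" using True by simp_all
    ultimately have "(i + 1) div 8 = i div 8" "(i + 1) mod 8 = i mod 8 + 1"
      by (simp_all only: div_mult_self1 mod_mult_self1 zero_neq_numeral[symmetric] not_False_eq_True add_0)
    then show ?thesis using True Suc.prems by (simp add: follows.inside pos_steps)
  next
    case False
    \<comment> \<open>The last digit is 7, so adding 1 carries into the higher digits and the link
      is one of type \<open>across\<close>.\<close>
    then have *: "i mod 8 = 7" using pos_mod_bound[of 8 i] by simp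
    then have i: "i = 8 * (i div 8) + 7" using mult_div_mod_eq[of 8 i] by simp
    then have e: "i + 1 = (i div 8 + 1) * 8" by simp
    have "(i + 1) div 8 = i div 8 + 1" by (subst e) simp
    moreover have "(i + 1) mod 8 = 0" by (subst e) simp
    moreover have "follows (pos n y (i div 8)) (pos n y (i div 8 + 1))"
    proof (rule Suc.IH)
      have "8 * (i div 8) + 8 < 8 * 8 ^ n" using Suc.prems(3) i by simp
      then show "i div 8 + 1 < 8 ^ n" by linarith
    qed (use Suc.prems in auto)
    ultimately show ?thesis using * by (simp add: follows.across)
  qed
qed simp

lemma follows_iff_pos:
  "follows x y \<longleftrightarrow> (\<exists>n z i. z \<in> steps \<and> 0 \<le> i \<and> i + 1 < 8 ^ n \<and> x = pos n z i \<and> y = pos n z (i + 1))"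
proof
  assume "follows x y"
  then show "\<exists>n z i. z \<in> steps \<and> 0 \<le> i \<and> i + 1 < 8 ^ n \<and> x = pos n z i \<and> y = pos n z (i + 1)"
  proof (induction rule: follows.induct)
    case (inside y j)
    then show ?case by (intro exI[of _ 1] exI[of _ y] exI[of _ j]) simp
  next
    case (across x y)
    then obtain n z i where "z \<in> steps" "0 \<le> i" "i + 1 < 8 ^ n" "x = pos n z i" "y = pos n z (i + 1)"
      by blast
    moreover have "(8 * i + 8) div 8 = i + 1" "(8 * i + 8) mod 8 = 0"
      using div_mult_self1[of 8 0 "i + 1"] by simp_all
    ultimately show ?case
      by (intro exI[of _ "Suc n"] exI[of _ z] exI[of _ "8 * i + 7"]) (simp add: add.commute)
  qed
qed (auto intro: follows_pos)

lemma head_pos: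
  assumes "y \<in> steps" "0 \<le> i" "i + 1 < 8 ^ n"
  shows "head (pos n y i) = fst (pos n y (i + 1))"
  using follows_head[OF follows_pos[OF assms]] by simp

lemma sub_doubled_theta:
  assumes "d \<in> directions" "doubled p"
  shows "sub (p, d) 0 = (scale 2 p, theta d)"
proof -
  obtain q where p: "p = scale 2 q" using assms(2) by (rule doubledE)
  have "sub (shift (scale 2 q) (0, d)) 0 = shift (scale 4 q) (sub (0, d) 0)"
    using assms by (intro sub_shift) (simp_all add: steps_def)
  then show ?thesis using assms by (simp add: sub_zero_theta p)
qed

text \<open>The steps leaving 2 p begin the curves that replace the steps leaving p, and links at 2
  p can only be induced by links at p. As p has even coordinates, the placing isometry has trivial
  linear part, so the same \<theta> serves at all these points.\<close>

lemma follows_theta: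
  assumes "doubled p" "u \<in> directions" "v \<in> directions"
  shows "follows (flip (scale 2 p, theta u)) (scale 2 p, theta v) \<longleftrightarrow> follows (flip (p, u)) (p, v)"
proof -
  have st: "(p, d) \<in> steps" if "d \<in> directions" for d using that by (simp add: steps_def)
  have "flip (scale 2 p, theta u) = sub (flip (p, u)) 7"
    using assms st by (simp add: sub_flip sub_doubled_theta del: step_pair_simps)
  moreover have "(scale 2 p, theta v) = sub (p, v) 0"
    using assms by (simp add: sub_doubled_theta)
  ultimately have "follows (flip (scale 2 p, theta u)) (scale 2 p, theta v) \<longleftrightarrow>
      (\<exists>z. follows (flip (p, u)) z \<and> sub (p, v) 0 = sub z 0)"
    using st assms by (simp add: follows_sub_iff del: step_pair_simps)
  also have "\<dots> \<longleftrightarrow> follows (flip (p, u)) (p, v)"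
    using follows_steps sub_inject st assms by (metis le_numeral_extra(3) zero_less_numeral)
  finally show ?thesis .
qed

section \<open>The powers of the covering\<close>

definition sub_curve :: "nat \<Rightarrow> step \<Rightarrow> segseq" where
  "sub_curve n y = (\<lambda>i. if 0 \<le> i \<and> i < 8 ^ n then Some (seg (pos n y i)) else None)"

lemma dom_sub_curve: "dom (sub_curve n y) = {0..<8 ^ n}"
  by (auto simp: sub_curve_def split: if_splits)

section \<open>Representatives of nonoriented curves\<close>

lemma nonoriented_self: "f \<in> nonoriented f"
  unfolding nonoriented_def by (auto intro!: exI[of _ 0])

lemma nonoriented_shift: "nonoriented (\<lambda>i. f (k + i)) = nonoriented f"
proof (intro set_eqI iffI)
  fix g assume "g \<in> nonoriented (\<lambda>i. f (k + i))"
  then obtain l where "g = (\<lambda>i. f (k + (l + i))) \<or> g = (\<lambda>i. f (k + (l - i)))"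
    by (auto simp: nonoriented_def)
  then show "g \<in> nonoriented f"
    unfolding nonoriented_def by (auto intro!: exI[of _ "k + l"] simp: algebra_simps)
next
  fix g assume "g \<in> nonoriented f"
  then obtain l where "g = (\<lambda>i. f (l + i)) \<or> g = (\<lambda>i. f (l - i))"
    by (auto simp: nonoriented_def)
  then show "g \<in> nonoriented (\<lambda>i. f (k + i))"
    unfolding nonoriented_def by (auto intro!: exI[of _ "l - k"] simp: algebra_simps)
qed

lemma nonoriented_reverse: "nonoriented (\<lambda>i. f (k - i)) = nonoriented f"
proof (intro set_eqI iffI)
  fix g assume "g \<in> nonoriented (\<lambda>i. f (k - i))"
  then obtain l where "g = (\<lambda>i. f (k - (l + i))) \<or> g = (\<lambda>i. f (k - (l - i)))"
    by (auto simp: nonoriented_def)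
  then show "g \<in> nonoriented f"
    unfolding nonoriented_def by (auto intro!: exI[of _ "k - l"] simp: algebra_simps)
next
  fix g assume "g \<in> nonoriented f"
  then obtain l where "g = (\<lambda>i. f (l + i)) \<or> g = (\<lambda>i. f (l - i))"
    by (auto simp: nonoriented_def)
  then show "g \<in> nonoriented (\<lambda>i. f (k - i))"
    unfolding nonoriented_def by (auto intro!: exI[of _ "k - l"] simp: algebra_simps)
qed

lemma sub_curve_flip:
  "y \<in> steps \<Longrightarrow> sub_curve n (flip y) = (\<lambda>i. sub_curve n y (8 ^ n - 1 - i))"
  by (auto simp: sub_curve_def pos_flip)

lemma nonoriented_sub_curve_flip:
  "y \<in> steps \<Longrightarrow> nonoriented (sub_curve n (flip y)) = nonoriented (sub_curve n y)"
  by (simp add: sub_curve_flip nonoriented_reverse)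

text \<open>A reversed representative for \<open>y\<close> is a forward one for
  \<open>flip y\<close>; this absorbs the orientation once and for all.\<close>

lemma nonoriented_sub_curveE:
  assumes "f \<in> nonoriented (sub_curve n y)" "y \<in> steps"
  obtains k z where "z \<in> steps" "f = (\<lambda>i. sub_curve n z (k + i))"
proof -
  obtain k where "f = (\<lambda>i. sub_curve n y (k + i)) \<or> f = (\<lambda>i. sub_curve n y (k - i))"
    using assms(1) by (auto simp: nonoriented_def)
  moreover have "(\<lambda>i. sub_curve n y (k - i)) = (\<lambda>i. sub_curve n (flip y) (8 ^ n - 1 - k + i))"
    using assms(2) by (simp add: sub_curve_flip algebra_simps)
  ultimately show ?thesis using that[of y k] that[of "flip y" "8 ^ n - 1 - k"] assms(2) by auto
qed

lemma vertex_path_curve_of: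
  assumes "y \<in> steps" shows "vertex_path (curve_of y) = sub_curve (Suc 0) y"
proof
  fix i show "vertex_path (curve_of y) i = sub_curve (Suc 0) y i"
    using assms by (auto simp: vertex_path_def sub_curve_def seg_def head_sub sub_def)
qed

section \<open>The powers of C as refinements of steps\<close>

lemma twirl_twirl: "twirl p (twirl p v) = v"
  by (cases p; cases v) auto

lemma twirl_dirs: "twirl p ` set dirs = set dirs"
proof -
  have "\<forall>d\<in>set dirs. twirl p d \<in> set dirs"
    by (cases p) (simp add: dirs_def)
  then have *: "twirl p d \<in> set dirs" if "d \<in> set dirs" for d
    using that by blast
  show ?thesis
  proof
    show "set dirs \<subseteq> twirl p ` set dirs"
    proof
      fix d assume "d \<in> set dirs"
      then have "twirl p d \<in> set dirs" by (rule *)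
      then show "d \<in> twirl p ` set dirs" using twirl_twirl[of p d] by (metis image_eqI)
    qed
  qed (use * in blast)
qed

lemma B0_eq: "B0 = root_curve ` set dirs"
  by (simp only: set_map[symmetric]) (simp add: B0_def dirs_def root_curve_def)

lemma even_curve_image:
  "even_curve ` ({p} \<times> set dirs) = map (\<lambda>v. scale 2 p + twirl p v) ` B0"
proof -
  have "even_curve ` ({p} \<times> set dirs) = (\<lambda>d. even_curve (p, d)) ` set dirs" by auto
  also have "\<dots> = (\<lambda>d. map (\<lambda>v. scale 2 p + twirl p v) (root_curve d)) ` twirl p ` set dirs"
    by (simp only: even_curve_def fst_conv snd_conv image_image)
  finally show ?thesis by (simp only: twirl_dirs B0_eq image_image)
qed

text \<open>The four residue classes modulo 2 of even coordinate sum account exactly for the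
  identity and the three isometries in the definition of C.\<close>

lemma base_paths_eq:
  "base_paths = even_curve ` ({(0,0,0), (1,1,0), (1,0,1), (0,1,1)} \<times> set dirs)"
proof -
  have 1: "(\<lambda>v. scale 2 (0,0,0) + twirl (0,0,0) v) = id"
    by (auto simp: fun_eq_iff)
  have 2: "(\<lambda>v. scale 2 (1,1,0) + twirl (1,1,0) v) = (\<lambda>(a, b, c). (2 + a, 2 - b, - c))"
    by (auto simp: fun_eq_iff)
  have 3: "(\<lambda>v. scale 2 (1,0,1) + twirl (1,0,1) v) = (\<lambda>(a, b, c). (2 - a, - b, 2 + c))"
    by (auto simp: fun_eq_iff)
  have 4: "(\<lambda>v. scale 2 (0,1,1) + twirl (0,1,1) v) = (\<lambda>(a, b, c). (- a, 2 + b, 2 - c))"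
    by (auto simp: fun_eq_iff)
  have 5: "{(0,0,0), (1,1,0), (1,0,1), (0,1,1)} \<times> set dirs
      = {(0,0,0)} \<times> set dirs \<union> {(1,1,0)} \<times> set dirs \<union> {(1,0,1)} \<times> set dirs \<union> {(0,1,1)} \<times> set dirs"
    by blast
  show ?thesis
    by (subst 5) (simp only: image_Un even_curve_image base_paths_def 1 2 3 4 list.map_id0 image_id id_apply)
qed

lemma C_cov_eq: "C_cov = {nonoriented (sub_curve (Suc 0) y) | y. y \<in> steps}"
proof (intro set_eqI iffI)
  fix \<gamma> assume "\<gamma> \<in> C_cov"
  then obtain u vs where \<gamma>: "\<gamma> = nonoriented (vertex_path (map (\<lambda>p. scale 4 u + p) vs))" "vs \<in> base_paths"
    by (auto simp: C_cov_def)
  then obtain p d where vs: "vs = even_curve (p, d)" "even_point p" "(p, d) \<in> steps"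
    by (auto simp: base_paths_eq steps_def directions_dirs)
  then have "map (\<lambda>p. scale 4 u + p) vs = curve_of (shift (scale 2 u) (p, d))"
    by (simp only: curve_of_shift) (simp add: curve_of_even)
  with \<gamma> vs show "\<gamma> \<in> {nonoriented (sub_curve (Suc 0) y) | y. y \<in> steps}"
    by (metis (mono_tags, lifting) mem_Collect_eq shift_steps vertex_path_curve_of)
next
  fix \<gamma> assume "\<gamma> \<in> {nonoriented (sub_curve (Suc 0) y) | y. y \<in> steps}"
  then obtain y where y: "y \<in> steps" "\<gamma> = nonoriented (sub_curve (Suc 0) y)" by blast
  have "nonoriented (sub_curve (Suc 0) y) \<in> C_cov" using y(1)
  proof (induction y rule: steps_even_induct)
    case (even y)
    obtain a b c w where p: "fst y = (a, b, c) + scale 2 w" "a \<in> {0..<2}" "b \<in> {0..<2}" "c \<in> {0..<2}"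
      by (rule reduce_mod[of 2 "fst y"]) auto
    have "even_point (a, b, c)" using even(2) p(1) by simp
    then have "(a, b, c) \<in> {(0,0,0), (1,1,0), (1,0,1), (0,1,1)}"
      using p(2-4) unfolding int_ranges by auto
    then have "even_curve ((a, b, c), snd y) \<in> base_paths"
      using even(1) unfolding base_paths_eq steps_def directions_dirs by auto
    moreover have y: "y = shift (scale 2 w) ((a, b, c), snd y)" using p(1) by (simp add: prod_eq_iff)
    have "curve_of y = map (\<lambda>p. scale 4 w + p) (even_curve ((a, b, c), snd y))"
      by (subst y, subst curve_of_shift) (simp add: curve_of_even \<open>even_point (a, b, c)\<close> del: even_point.simps)
    ultimately show ?case
      using vertex_path_curve_of[OF even(1)] unfolding C_cov_def by (metis (mono_tags, lifting) mem_Collect_eq)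
  qed (simp add: nonoriented_sub_curve_flip)
  with y show "\<gamma> \<in> C_cov" by simp
qed

text \<open>Two consecutive segments share exactly one point, because the curve does not turn back;
  this forces their common vertex and then the others. A single segment would leave its direction
  open, hence \<open>n > 0\<close>.\<close>

lemma vertices_unique:
  assumes "y \<in> steps" and n: "n > 0"
    and v: "\<And>i. 0 \<le> i \<Longrightarrow> i < 8 ^ n \<Longrightarrow> seg (pos n y i) = {v i, v (i + 1)}"
    and i: "0 \<le> i" "i < 8 ^ n"
  shows "v i = fst (pos n y i) \<and> v (i + 1) = head (pos n y i)"
proof -
  have inner: "v (i + 1) = head (pos n y i) \<and> v i = fst (pos n y i)" if i: "0 \<le> i" "i + 1 < 8 ^ n" for i
  proof -
    let ?x = "pos n y i" and ?z = "pos n y (i + 1)"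
    have f: "follows ?x ?z" using assms(1) i by (rule follows_pos)
    have eq: "{fst ?x, head ?x} = {v i, v (i + 1)}" "{head ?x, head ?z} = {v (i + 1), v (i + 1 + 1)}"
      using v[of i] v[of "i + 1"] i follows_head[OF f] by (auto simp: seg_def)
    have "fst ?x \<noteq> head ?x" using fst_neq_head follows_steps f by blast
    moreover have "fst ?x \<noteq> head ?z"
      using follows_not_flip[OF f] follows_head[OF f] step_eqI[of ?z "flip ?x"] by auto
    ultimately show ?thesis using eq by (auto simp: doubleton_eq_iff)
  qed
  show ?thesis
  proof (cases "i + 1 < 8 ^ n")
    case False
    \<comment> \<open>The last segment has no successor; its first vertex is obtained from its
      predecessor, which exists since there are at least 8 segments.\<close>
    have "(8 :: int) ^ n \<ge> 8 ^ 1" using n by (intro power_increasing) auto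
    then have i: "0 \<le> i - 1" "i - 1 + 1 < 8 ^ n" using False i by auto
    have "v i = fst (pos n y i)"
      using inner[OF i] head_pos[OF assms(1) i] by simp
    moreover have "{fst (pos n y i), head (pos n y i)} = {v i, v (i + 1)}"
      using v[of i] assms(4,5) by (simp add: seg_def)
    ultimately show ?thesis by (auto simp: doubleton_eq_iff)
  qed (use inner i in blast)
qed

lemma replaces_shift:
  assumes "replaces g f" shows "replaces (\<lambda>i. g (8 * k + i)) (\<lambda>i. f (k + i))"
proof -
  obtain v w where d: "dom g = {j. j div 8 \<in> dom f}" and v: "has_vertices f v" "has_vertices g w"
    and b: "\<And>i. i \<in> dom f \<Longrightarrow> w (8 * i) = scale 2 (v i) \<and> w (8 * i + 8) = scale 2 (v (i + 1)) \<and>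
           nonoriented (\<lambda>j. if 0 \<le> j \<and> j < 8 then g (8 * i + j) else None) \<in> C_cov"
    using assms unfolding replaces_def by blast
  show ?thesis
    unfolding replaces_def
  proof (intro conjI exI ballI)
    show "dom (\<lambda>i. g (8 * k + i)) = {j. j div 8 \<in> dom (\<lambda>i. f (k + i))}"
    proof (intro set_eqI)
      fix j
      have "(8 * k + j) div 8 = k + j div 8" by simp
      moreover have "8 * k + j \<in> dom g \<longleftrightarrow> (8 * k + j) div 8 \<in> dom f" by (simp add: d)
      ultimately show "j \<in> dom (\<lambda>i. g (8 * k + i)) \<longleftrightarrow> j \<in> {j. j div 8 \<in> dom (\<lambda>i. f (k + i))}"
        by (simp add: dom_def)
    qed
    show "has_vertices (\<lambda>i. f (k + i)) (\<lambda>i. v (k + i))"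
      using v(1) by (auto simp: has_vertices_def dom_def add.assoc)
    show "has_vertices (\<lambda>i. g (8 * k + i)) (\<lambda>i. w (8 * k + i))"
      using v(2) by (auto simp: has_vertices_def dom_def add.assoc)
    fix i assume "i \<in> dom (\<lambda>i. f (k + i))"
    then have "k + i \<in> dom f" by (auto simp: dom_def)
    from b[OF this, unfolded distrib_left add.assoc] show "w (8 * k + 8 * i) = scale 2 (v (k + i))"
      "w (8 * k + (8 * i + 8)) = scale 2 (v (k + (i + 1)))"
      "nonoriented (\<lambda>j. if 0 \<le> j \<and> j < 8 then g (8 * k + (8 * i + j)) else None) \<in> C_cov"
      by blast+
  qed
qed

lemma sub_curve_Suc_block:
  assumes "0 \<le> i" "i < 8 ^ n"
  shows "(\<lambda>j. if 0 \<le> j \<and> j < 8 then sub_curve (Suc n) y (8 * i + j) else None)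
    = sub_curve (Suc 0) (pos n y i)"
proof
  fix j
  have "0 \<le> 8 * i + j" "8 * i + j < 8 * 8 ^ n" if "0 \<le> j" "j < 8"
    using assms that by linarith+
  then show "(if 0 \<le> j \<and> j < 8 then sub_curve (Suc n) y (8 * i + j) else None)
    = sub_curve (Suc 0) (pos n y i) j"
    by (auto simp: sub_curve_def)
qed

lemma replaces_sub_curve:
  assumes "y \<in> steps"
  shows "replaces (sub_curve (Suc n) y) (sub_curve n y)"
proof -
  \<comment> \<open>The final vertex starts no step in range and is read off as the head of the last
    one.\<close>
  define v where "v m i = (if i < 8 ^ m then fst (pos m y i) else head (pos m y (i - 1)))" for m i
  have hv: "v m i = fst (pos m y i) \<and> v m (i + 1) = head (pos m y i)" if "0 \<le> i" "i < 8 ^ m" for m i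
    using that assms by (auto simp: v_def head_pos)
  have "has_vertices (sub_curve m y) (v m)" for m
    using hv[of _ m] by (auto simp: has_vertices_def sub_curve_def seg_def split: if_splits)
  moreover have "v (Suc n) (8 * i) = scale 2 (v n i) \<and> v (Suc n) (8 * i + 8) = scale 2 (v n (i + 1)) \<and>
      nonoriented (\<lambda>j. if 0 \<le> j \<and> j < 8 then sub_curve (Suc n) y (8 * i + j) else None) \<in> C_cov"
    if "i \<in> dom (sub_curve n y)" for i
  proof -
    have i: "0 \<le> i" "i < 8 ^ n" using that by (auto simp: dom_sub_curve)
    then have "0 \<le> 8 * i" "8 * i < 8 ^ Suc n" "0 \<le> 8 * i + 7" "8 * i + 7 < 8 ^ Suc n" by simp_all
    moreover have e: "8 * i + 7 + 1 = 8 * i + 8" by simp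
    ultimately have "v (Suc n) (8 * i) = fst (pos (Suc n) y (8 * i))"
      "v (Suc n) (8 * i + 8) = head (pos (Suc n) y (8 * i + 7))"
      using hv[of "8 * i" "Suc n"] hv[of "8 * i + 7" "Suc n", unfolded e] by blast+
    with hv[OF i]
    have "v (Suc n) (8 * i) = scale 2 (v n i)" "v (Suc n) (8 * i + 8) = scale 2 (v n (i + 1))"
      using assms by (simp_all add: fst_sub_0 head_sub_7 pos_steps)
    then show ?thesis
      using i assms by (auto simp: sub_curve_Suc_block C_cov_eq pos_steps)
  qed
  moreover have "dom (sub_curve (Suc n) y) = {j. j div 8 \<in> dom (sub_curve n y)}"
    by (auto simp: dom_sub_curve)
  ultimately show ?thesis unfolding replaces_def by blast
qed

text \<open>Only for a single segment can the vertices run against \<open>y\<close>; then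
  \<open>flip y\<close> has the same sequence of segments and matches them.\<close>

lemma sub_curve_vertices:
  assumes y: "y \<in> steps" and v: "has_vertices (sub_curve n y) v"
  obtains z where "z \<in> steps" "sub_curve n z = sub_curve n y"
    "\<And>i. 0 \<le> i \<Longrightarrow> i < 8 ^ n \<Longrightarrow> v i = fst (pos n z i) \<and> v (i + 1) = head (pos n z i)"
proof (cases "n = 0")
  case True
  have "{v 0, v 1} = seg y"
    using bspec[OF v[unfolded has_vertices_def], of 0] True by (simp add: dom_sub_curve) (simp add: sub_curve_def)
  then have "v 0 = fst y \<and> v 1 = head y \<or> v 0 = head y \<and> v 1 = fst y"
    by (auto simp: seg_def doubleton_eq_iff)
  then show ?thesis
  proof
    assume *: "v 0 = fst y \<and> v 1 = head y"
    show ?thesis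
    proof (rule that[of y])
      fix i :: int assume "0 \<le> i" "i < 8 ^ n"
      then have "i = 0" using True by simp
      then show "v i = fst (pos n y i) \<and> v (i + 1) = head (pos n y i)" using * True by simp
    qed (simp_all add: y)
  next
    assume *: "v 0 = head y \<and> v 1 = fst y"
    show ?thesis
    proof (rule that[of "flip y"])
      fix i :: int assume "0 \<le> i" "i < 8 ^ n"
      then have "i = 0" using True by simp
      then show "v i = fst (pos n (flip y) i) \<and> v (i + 1) = head (pos n (flip y) i)" using * True by simp
    qed (auto simp: y True sub_curve_def fun_eq_iff)
  qed
next
  case False
  have "seg (pos n y i) = {v i, v (i + 1)}" if "0 \<le> i" "i < 8 ^ n" for i
    using bspec[OF v[unfolded has_vertices_def], of i] that
    by (simp add: dom_sub_curve) (simp add: sub_curve_def)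
  then show ?thesis using that[of y] vertices_unique[OF y, of n v] False y by blast
qed

lemma replaces_sub_curveD:
  assumes y: "y \<in> steps" and r: "replaces g (sub_curve n y)"
  obtains z where "z \<in> steps" "g = sub_curve (Suc n) z"
proof -
  obtain v w where d: "dom g = {j. j div 8 \<in> dom (sub_curve n y)}"
    and v: "has_vertices (sub_curve n y) v" and w: "has_vertices g w"
    and b: "\<And>i. i \<in> dom (sub_curve n y) \<Longrightarrow> w (8 * i) = scale 2 (v i) \<and> w (8 * i + 8) = scale 2 (v (i + 1)) \<and>
           nonoriented (\<lambda>j. if 0 \<le> j \<and> j < 8 then g (8 * i + j) else None) \<in> C_cov"
    using r unfolding replaces_def by blast
  obtain z where z: "z \<in> steps" "sub_curve n z = sub_curve n y"
    "\<And>i. 0 \<le> i \<Longrightarrow> i < 8 ^ n \<Longrightarrow> v i = fst (pos n z i) \<and> v (i + 1) = head (pos n z i)"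
    using sub_curve_vertices[OF y v] by blast
  \<comment> \<open>Each block is a curve of C in an unknown orientation and indexing. Its domain
    forces the offset to be 0, and its prescribed end vertices identify the step that it
    refines.\<close>
  have block: "(\<lambda>j. if 0 \<le> j \<and> j < 8 then g (8 * i + j) else None) = sub_curve (Suc 0) (pos n z i)"
    if i: "0 \<le> i" "i < 8 ^ n" for i
  proof -
    let ?B = "\<lambda>j. if 0 \<le> j \<and> j < 8 then g (8 * i + j) else None"
    have bi: "w (8 * i) = scale 2 (v i)" "w (8 * i + 8) = scale 2 (v (i + 1))" "nonoriented ?B \<in> C_cov"
      using b[of i] i by (auto simp: dom_sub_curve)
    have dg: "8 * i + j \<in> dom g" if "0 \<le> j" "j < 8" for j
      using i that by (simp add: d dom_sub_curve)
    have dB: "dom ?B = {0..<8}"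
      using dg by (auto simp: dom_def)
    obtain u where u: "u \<in> steps" "nonoriented ?B = nonoriented (sub_curve (Suc 0) u)"
      using bi(3) by (auto simp: C_cov_eq)
    have "?B \<in> nonoriented (sub_curve (Suc 0) u)" unfolding u(2)[symmetric] by (rule nonoriented_self)
    then obtain k x where x: "x \<in> steps" "?B = (\<lambda>i. sub_curve (Suc 0) x (k + i))"
      by (rule nonoriented_sub_curveE[OF _ u(1)])
    have "dom ?B = {- k..<8 - k}"
      unfolding x(2) by (auto simp: sub_curve_def split: if_splits)
    then have "{0..<8} = {- k..<8 - k}" using dB by simp
    then have "k = 0" by (simp add: atLeastLessThan_eq_iff)
    then have B: "?B = sub_curve (Suc 0) x" using x(2) by simp
    have "seg (pos (Suc 0) x j) = {w (8 * i + j), w (8 * i + (j + 1))}" if "0 \<le> j" "j < 8 ^ Suc 0" for j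
    proof -
      have "g (8 * i + j) = Some {w (8 * i + j), w (8 * i + j + 1)}"
        using w dg[of j] that by (auto simp: has_vertices_def)
      moreover have "g (8 * i + j) = Some (seg (pos (Suc 0) x j))"
        using fun_cong[OF B, of j] that by (simp add: sub_curve_def)
      ultimately show ?thesis by (simp add: add.assoc)
    qed
    note vu = vertices_unique[OF x(1), of "Suc 0" "\<lambda>j. w (8 * i + j)", OF _ this]
    have "w (8 * i) = scale 2 (fst x)" "w (8 * i + 8) = scale 2 (head x)"
      using vu[of 0] vu[of 7] x(1) by (simp_all add: fst_sub_0 head_sub_7)
    then have "x = pos n z i"
      using bi(1,2) z(3)[OF i] by (intro step_eqI) (simp_all add: scale_eq_iff)
    then show ?thesis using B by simp
  qed
  have "g = sub_curve (Suc n) z"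
  proof
    fix j
    show "g j = sub_curve (Suc n) z j"
    proof (cases "0 \<le> j \<and> j < 8 ^ Suc n")
      case True
      then have i: "0 \<le> j div 8" "j div 8 < 8 ^ n" by auto
      have "g (8 * (j div 8) + j mod 8) = sub_curve (Suc 0) (pos n z (j div 8)) (j mod 8)"
        using fun_cong[OF block[OF i], of "j mod 8"] by simp
      also have "\<dots> = sub_curve (Suc n) z j"
        using True by (simp add: sub_curve_def)
      finally show ?thesis by simp
    next
      case False
      then have "j \<notin> dom g" by (auto simp: d dom_sub_curve)
      then show ?thesis using False by (auto simp: sub_curve_def)
    qed
  qed
  with z(1) show ?thesis by (rule that)
qed

lemma C_pow_eq: "C_pow n = {nonoriented (sub_curve n y) | y. y \<in> steps}"
proof (induction n)
  case 0
  have "[0 \<mapsto> seg y] = sub_curve 0 y" for y by (auto simp: sub_curve_def)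
  then show ?case unfolding C_pow.simps segments_eq by (metis (no_types, lifting) imageE imageI)
next
  case (Suc n)
  show ?case
  proof (intro set_eqI iffI)
    fix \<gamma> assume "\<gamma> \<in> C_pow (Suc n)"
    then obtain g f \<delta> where g: "\<gamma> = nonoriented g" "\<delta> \<in> C_pow n" "f \<in> \<delta>" "replaces g f"
      by (auto simp: C_star_def)
    then obtain y where "y \<in> steps" "f \<in> nonoriented (sub_curve n y)" using Suc by auto
    then obtain k z where z: "z \<in> steps" "f = (\<lambda>i. sub_curve n z (k + i))"
      using nonoriented_sub_curveE by metis
    have "replaces (\<lambda>i. g (8 * (- k) + i)) (\<lambda>i. f (- k + i))" using g(4) by (rule replaces_shift)
    then have "replaces (\<lambda>i. g (8 * (- k) + i)) (sub_curve n z)" by (simp add: z(2))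
    then obtain u where "u \<in> steps" "(\<lambda>i. g (8 * (- k) + i)) = sub_curve (Suc n) u"
      using replaces_sub_curveD z(1) by metis
    then show "\<gamma> \<in> {nonoriented (sub_curve (Suc n) y) | y. y \<in> steps}"
      using g(1) nonoriented_shift[of g "8 * (- k)"] by auto
  next
    fix \<gamma> assume "\<gamma> \<in> {nonoriented (sub_curve (Suc n) y) | y. y \<in> steps}"
    then obtain y where y: "y \<in> steps" "\<gamma> = nonoriented (sub_curve (Suc n) y)" by blast
    then have "nonoriented (sub_curve n y) \<in> C_pow n" using Suc by blast
    then show "\<gamma> \<in> C_pow (Suc n)"
      using y replaces_sub_curve[OF y(1), of n] nonoriented_self[of "sub_curve n y"]
      unfolding C_pow.simps C_star_def by blast
  qed
qed

definition seg_pairs :: "(step \<Rightarrow> step \<Rightarrow> bool) \<Rightarrow> (segment \<times> segment) set" where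
  "seg_pairs S = {(seg x, seg y) | x y. S x y}"

lemma connexions_C_pow:
  "connexions (C_pow n) =
    {(seg (pos n y i), seg (pos n y (i + 1))) | y i. y \<in> steps \<and> 0 \<le> i \<and> i + 1 < 8 ^ n}"
proof (intro set_eqI iffI)
  fix st assume "st \<in> connexions (C_pow n)"
  then obtain y f i s t where st: "st = (s, t)" "y \<in> steps" "f \<in> nonoriented (sub_curve n y)"
    "f i = Some s" "f (i + 1) = Some t"
    by (auto simp: connexions_def C_pow_eq)
  then obtain k z where "z \<in> steps" "f = (\<lambda>i. sub_curve n z (k + i))"
    using nonoriented_sub_curveE by metis
  with st show "st \<in> {(seg (pos n y i), seg (pos n y (i + 1))) | y i. y \<in> steps \<and> 0 \<le> i \<and> i + 1 < 8 ^ n}"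
    by (auto simp: sub_curve_def add.assoc split: if_splits intro!: exI[of _ z] exI[of _ "k + i"])
next
  fix st assume "st \<in> {(seg (pos n y i), seg (pos n y (i + 1))) | y i. y \<in> steps \<and> 0 \<le> i \<and> i + 1 < 8 ^ n}"
  then obtain y i where "st = (seg (pos n y i), seg (pos n y (i + 1)))" "y \<in> steps" "0 \<le> i" "i + 1 < 8 ^ n"
    by blast
  moreover from this have "sub_curve n y i = Some (seg (pos n y i))" "sub_curve n y (i + 1) = Some (seg (pos n y (i + 1)))"
    by (auto simp: sub_curve_def)
  ultimately show "st \<in> connexions (C_pow n)"
    using nonoriented_self[of "sub_curve n y"] unfolding connexions_def C_pow_eq by blast
qed

lemma C_hat_connexions_eq: "C_hat_connexions = seg_pairs follows"
  unfolding C_hat_connexions_def connexions_C_pow seg_pairs_def follows_iff_pos by blast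

section \<open>Complete connexion relations and local isomorphism\<close>

text \<open>A connexion relation that continues every step uniquely and is compatible with reversal; it
  determines a set of curves without endpoints.\<close>

definition linking :: "(step \<Rightarrow> step \<Rightarrow> bool) \<Rightarrow> bool" where
  "linking S \<longleftrightarrow>
     (\<forall>x y. S x y \<longrightarrow> x \<in> steps \<and> y \<in> steps \<and> fst y = head x \<and> y \<noteq> flip x \<and> S (flip y) (flip x)) \<and>
     (\<forall>x\<in>steps. \<exists>!y. S x y)"

lemma linkingD:
  assumes "linking S" "S x y"
  shows "x \<in> steps" "y \<in> steps" "fst y = head x" "y \<noteq> flip x" "S (flip y) (flip x)"
  using assms unfolding linking_def by blast+

section \<open>Curves without endpoints obtained from a linking\<close>

lemma linking_ex: "linking S \<Longrightarrow> x \<in> steps \<Longrightarrow> \<exists>y. S x y"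
  unfolding linking_def by blast

lemma linking_unique:
  assumes "linking S" "S x y" "S x z" shows "y = z"
proof -
  have "x \<in> steps" using linkingD(1) assms by blast
  then show ?thesis using assms unfolding linking_def by blast
qed

lemma linking_seg_Int:
  assumes "linking S" "S x y" shows "seg x \<inter> seg y = {head x}"
proof -
  note l = linkingD[OF assms]
  have "fst x \<noteq> head x" using l(1) by (rule fst_neq_head)
  moreover have "fst x \<noteq> head y" using l(3,4) step_eqI[of y "flip x"] by auto
  ultimately show ?thesis using l(3) by (auto simp: seg_def)
qed

lemma linking_walk:
  assumes S: "linking S" and x: "x \<in> steps"
  shows "\<exists>c :: int \<Rightarrow> step. c 0 = x \<and> (\<forall>i. S (c i) (c (i + 1)))"
proof -
  define nxt where "nxt u = (SOME v. S u v)" for u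
  have nxt: "S u (nxt u)" if "u \<in> steps" for u
    unfolding nxt_def using linking_ex[OF S that] by (rule someI_ex)
  have st: "(nxt ^^ n) u \<in> steps" if "u \<in> steps" for n u
  proof (induction n)
    case (Suc n)
    then show ?case using linkingD(2)[OF S nxt] by simp
  qed (use that in simp)
  \<comment> \<open>The backward half is the forward walk from the reversed step, reversed
    again.\<close>
  define c where "c i = (if i \<ge> 0 then (nxt ^^ nat i) x else flip ((nxt ^^ nat (- i)) (flip x)))" for i
  have "S (c i) (c (i + 1))" for i
  proof (cases "i \<ge> 0")
    case True
    then have "nat (i + 1) = Suc (nat i)" by simp
    then show ?thesis using True nxt[OF st[OF x]] by (simp add: c_def)
  next
    case False
    define n where "n = nat (- i - 1)"
    have n: "nat (- i) = Suc n" "i + 1 = - int n" using False by (auto simp: n_def)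
    have "S ((nxt ^^ n) (flip x)) ((nxt ^^ Suc n) (flip x))"
      using nxt[OF st] x by simp
    then have "S (flip ((nxt ^^ Suc n) (flip x))) (flip ((nxt ^^ n) (flip x)))"
      using linkingD(5)[OF S] by blast
    then show ?thesis using False n by (auto simp: c_def)
  qed
  then show ?thesis by (intro exI[of _ c]) (simp add: c_def)
qed

lemma walk_curve_seq:
  assumes "linking S" "\<And>i. S (c i) (c (i + 1))"
  shows "curve_seq (\<lambda>i. Some (seg (c i)))"
proof -
  have st: "c i \<in> steps" for i using linkingD(1)[OF assms] .
  have int: "seg (c i) \<inter> seg (c (i + 1)) = {head (c i)}" for i
    using linking_seg_Int assms .
  have "seg (c (i - 1)) \<inter> seg (c i) \<noteq> seg (c i) \<inter> seg (c (i + 1))" for i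
  proof -
    have "fst (c i) = head (c (i - 1))" using linkingD(3)[OF assms(1) assms(2)[of "i - 1"]] by simp
    then show ?thesis using int[of i] int[of "i - 1"] fst_neq_head[OF st[of i]] by simp
  qed
  moreover have "ran (\<lambda>i. Some (seg (c i))) \<subseteq> segments"
    using st by (auto simp: ran_def segments_eq)
  moreover have "dom (\<lambda>i. Some (seg (c i))) = UNIV" by auto
  ultimately show ?thesis
    unfolding curve_seq_def by (simp add: int)
qed

lemma seg_pairsE:
  assumes "linking S" "(seg x, t) \<in> seg_pairs S"
  obtains y where "t = seg y" "S x y \<or> S (flip x) y"
proof -
  obtain a b where ab: "seg x = seg a" "t = seg b" "S a b"
    using assms(2) unfolding seg_pairs_def by blast
  have "a = x \<or> a = flip x" using ab(1) unfolding seg_eq_iff by (metis flip_flip)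
  then show ?thesis using that[of b] ab(2,3) by blast
qed

lemma seg_pairs_sym:
  assumes "linking S" "(s, t) \<in> seg_pairs S" shows "(t, s) \<in> seg_pairs S"
proof -
  obtain x y where xy: "s = seg x" "t = seg y" "S x y" using assms(2) unfolding seg_pairs_def by blast
  then have "S (flip y) (flip x)" using linkingD(5)[OF assms(1)] by blast
  then have "(seg (flip y), seg (flip x)) \<in> seg_pairs S" unfolding seg_pairs_def by blast
  then show ?thesis by (simp add: xy)
qed

text \<open>The walk is maximal: a segment has just one continuation at each of its two ends, and a
  walk indexed by all integers uses both.\<close>

lemma walk_connected_by:
  assumes S: "linking S" and c: "\<And>i. S (c i) (c (i + 1))"
  shows "nonoriented (\<lambda>i. Some (seg (c i))) \<in> curves_connected_by (seg_pairs S)"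
proof -
  let ?f = "\<lambda>i. Some (seg (c i))"
  have "?f (i - 1) = Some t \<or> ?f (i + 1) = Some t" if t: "(seg (c i), t) \<in> seg_pairs S" for i t
  proof -
    obtain y where y: "t = seg y" "S (c i) y \<or> S (flip (c i)) y"
      using seg_pairsE[OF S t] by blast
    have "S (flip (c i)) (flip (c (i - 1)))" using linkingD(5)[OF S c[of "i - 1"]] by simp
    then have "y = c (i + 1) \<or> y = flip (c (i - 1))"
      using y(2) linking_unique[OF S] c[of i] by blast
    then show ?thesis using y(1) by auto
  qed
  moreover have "(seg (c i), seg (c (i + 1))) \<in> seg_pairs S" for i
    using c unfolding seg_pairs_def by blast
  ultimately show ?thesis
    unfolding curves_connected_by_def using walk_curve_seq[of S c, OF S c]
    by (intro CollectI exI[of _ ?f] conjI) auto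
qed

lemma connexions_connected_by:
  assumes S: "linking S"
  shows "connexions (curves_connected_by (seg_pairs S)) = seg_pairs S"
proof (intro set_eqI iffI)
  fix st assume "st \<in> connexions (curves_connected_by (seg_pairs S))"
  then obtain s t f g i where st: "st = (s, t)" "g \<in> nonoriented f" "g i = Some s" "g (i + 1) = Some t"
    and f: "\<And>i s t. f i = Some s \<Longrightarrow> f (i + 1) = Some t \<Longrightarrow> (s, t) \<in> seg_pairs S"
    unfolding connexions_def curves_connected_by_def by blast
  obtain k where "g = (\<lambda>i. f (k + i)) \<or> g = (\<lambda>i. f (k - i))"
    using st(2) unfolding nonoriented_def by blast
  then show "st \<in> seg_pairs S"
  proof
    assume "g = (\<lambda>i. f (k + i))"
    then show ?thesis using st(1,3,4) f[of "k + i" s t] by (simp add: add.assoc)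
  next
    assume "g = (\<lambda>i. f (k - i))"
    then have "(t, s) \<in> seg_pairs S" using st(3,4) f[of "k - (i + 1)" t s] by simp
    then show ?thesis using seg_pairs_sym[OF S] st(1) by blast
  qed
next
  fix st assume "st \<in> seg_pairs S"
  then obtain x y where xy: "st = (seg x, seg y)" "S x y" unfolding seg_pairs_def by blast
  obtain c :: "int \<Rightarrow> step" where c0: "c 0 = x" and c': "\<forall>i. S (c i) (c (i + 1))"
    using linking_walk[OF S linkingD(1)[OF S xy(2)]] by (elim exE conjE)
  note c = c0 c'[rule_format]
  have "c (0 + 1) = y" using linking_unique[OF S xy(2), of "c (0 + 1)"] c(1) c(2)[of 0] by simp
  let ?f = "\<lambda>i. Some (seg (c i))"
  have "?f 0 = Some (seg x) \<and> ?f (0 + 1) = Some (seg y)"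
    using c(1) \<open>c (0 + 1) = y\<close> by simp
  then have "\<exists>\<gamma>\<in>curves_connected_by (seg_pairs S). \<exists>f\<in>\<gamma>. \<exists>i. f i = Some (seg x) \<and> f (i + 1) = Some (seg y)"
    by (intro bexI[OF _ walk_connected_by[of S c, OF S c(2)]] bexI[OF _ nonoriented_self] exI[of _ 0])
  then show "st \<in> connexions (curves_connected_by (seg_pairs S))"
    unfolding connexions_def xy(1) mem_Collect_eq prod.case .
qed

lemma segments_connected_by:
  assumes S: "linking S"
  shows "\<Union> (segs_of ` curves_connected_by (seg_pairs S)) = segments"
proof (intro set_eqI iffI)
  fix s assume "s \<in> \<Union> (segs_of ` curves_connected_by (seg_pairs S))"
  then obtain f g where "curve_seq f" "g \<in> nonoriented f" "s \<in> ran g"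
    unfolding curves_connected_by_def segs_of_def by blast
  then show "s \<in> segments"
    unfolding nonoriented_def curve_seq_def ran_def by blast
next
  fix s assume "s \<in> segments"
  then obtain x where x: "x \<in> steps" "s = seg x" unfolding segments_eq by blast
  obtain c :: "int \<Rightarrow> step" where c0: "c 0 = x" and c': "\<forall>i. S (c i) (c (i + 1))"
    using linking_walk[OF S x(1)] by (elim exE conjE)
  note c = c0 c'[rule_format]
  have "s \<in> ran (\<lambda>i. Some (seg (c i)))" using c(1) x(2) by (auto simp: ran_def)
  then have "s \<in> segs_of (nonoriented (\<lambda>i. Some (seg (c i))))"
    unfolding segs_of_def by (rule UN_I[OF nonoriented_self])
  then show "s \<in> \<Union> (segs_of ` curves_connected_by (seg_pairs S))"
    by (rule UN_I[OF walk_connected_by[of S c, OF S c(2)]])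
qed

definition linked_at_0 :: "(point \<times> point) set \<Rightarrow> step \<Rightarrow> step \<Rightarrow> bool" where
  "linked_at_0 R x y \<longleftrightarrow> follows x y \<or> (\<exists>u v. (u, v) \<in> R \<and> x = flip (0, u) \<and> y = (0, v))"

text \<open>The two sources of links do not interfere: \<open>follows\<close> continues exactly the
  steps whose head is not 0, and the pairing those that arrive at 0.\<close>

lemma linking_linked_at_0:
  assumes R: "pairing R" shows "linking (linked_at_0 R)"
proof -
  have R': "R \<subseteq> directions \<times> directions" "sym R" "irrefl R"
    "\<And>u. u \<in> directions \<Longrightarrow> \<exists>!v. (u, v) \<in> R"
    using R unfolding pairing_def by blast+
  have "x \<in> steps \<and> y \<in> steps \<and> fst y = head x \<and> y \<noteq> flip x \<and> linked_at_0 R (flip y) (flip x)"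
    if "linked_at_0 R x y" for x y
    using that unfolding linked_at_0_def
  proof
    assume "follows x y"
    then show "x \<in> steps \<and> y \<in> steps \<and> fst y = head x \<and> y \<noteq> flip x \<and>
        (follows (flip y) (flip x) \<or> (\<exists>u v. (u, v) \<in> R \<and> flip y = flip (0, u) \<and> flip x = (0, v)))"
      using follows_steps follows_head follows_not_flip follows_flip by metis
  next
    assume "\<exists>u v. (u, v) \<in> R \<and> x = flip (0, u) \<and> y = (0, v)"
    then obtain u v where uv: "(u, v) \<in> R" "x = flip (0, u)" "y = (0, v)" by blast
    then have "(0, u) \<in> steps" "(0, v) \<in> steps" "u \<noteq> v" "(v, u) \<in> R"
      using R'(1-3) by (auto simp: steps_def irrefl_def dest: symD)
    then show "x \<in> steps \<and> y \<in> steps \<and> fst y = head x \<and> y \<noteq> flip x \<and>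
        (follows (flip y) (flip x) \<or> (\<exists>u v. (u, v) \<in> R \<and> flip y = flip (0, u) \<and> flip x = (0, v)))"
      using uv(2,3) by (simp only: flip_steps flip_flip head_flip fst_conv) blast
  qed
  moreover have "\<exists>!y. linked_at_0 R x y" if x: "x \<in> steps" for x
  proof (cases "head x = 0")
    case False
    then have "x \<noteq> flip (0, u)" for u using head_flip[of "(0, u)"] by (metis fst_conv)
    then have "linked_at_0 R x y \<longleftrightarrow> follows x y" for y unfolding linked_at_0_def by blast
    then show ?thesis using follows_ex[OF x False] follows_unique by blast
  next
    case True
    define u where "u = snd (flip x)"
    have u: "flip x = (0, u)" using True by (simp add: u_def prod_eq_iff)
    then have xu: "x = flip (0, u)" by (metis flip_flip)
    have "u \<in> directions" using x u flip_steps[of x] by (simp add: steps_def)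
    then obtain v where v: "(u, v) \<in> R" "\<And>w. (u, w) \<in> R \<Longrightarrow> w = v" using R'(4) by blast
    have "linked_at_0 R x y \<longleftrightarrow> (\<exists>u v. (u, v) \<in> R \<and> x = flip (0, u) \<and> y = (0, v))" for y
      using follows_head_nonzero True unfolding linked_at_0_def by blast
    moreover have "x = flip (0, w) \<longleftrightarrow> w = u" for w using u xu by (metis flip_flip snd_conv)
    ultimately show ?thesis using v by metis
  qed
  ultimately show ?thesis unfolding linking_def by blast
qed

lemma C_hat_eq: "C_hat R = curves_connected_by (seg_pairs (linked_at_0 R))"
proof -
  have "seg (flip (0, u)) = {0, u}" "seg (0, u) = {0, u}" for u
    by (auto simp: seg_def)
  then have "{({0, u}, {0, v}) | u v. (u, v) \<in> R} = {(seg (flip (0, u)), seg (0, v)) | u v. (u, v) \<in> R}"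
    by (simp only:)
  then have "C_hat_connexions \<union> {({0, u}, {0, v}) | u v. (u, v) \<in> R} = seg_pairs (linked_at_0 R)"
    unfolding C_hat_connexions_eq seg_pairs_def linked_at_0_def by blast
  then show ?thesis unfolding C_hat_def by simp
qed

text \<open>Only one implication is demanded, so that \<open>follows\<close>, which stops at 0 and
  is not a linking, can take either place. Between linkings uniqueness supplies the converse, see
  \<open>agree_iff\<close>.\<close>

definition agree :: "(step \<Rightarrow> step \<Rightarrow> bool) \<Rightarrow> (step \<Rightarrow> step \<Rightarrow> bool) \<Rightarrow> point \<Rightarrow> point set \<Rightarrow> bool" where
  "agree S T w X \<longleftrightarrow> (\<forall>x y. head x \<in> X \<longrightarrow> S x y \<longrightarrow> T (shift w x) (shift w y))"

lemma agree_trans: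
  assumes "agree S T w X" "agree T U v ((+) w ` X)" shows "agree S U (w + v) X"
  unfolding agree_def
proof (intro allI impI)
  fix x y assume x: "head x \<in> X" "S x y"
  then have "T (shift w x) (shift w y)" using assms(1) unfolding agree_def by blast
  moreover have "head (shift w x) \<in> (+) w ` X" using x(1) by (simp add: add.commute)
  ultimately have "U (shift v (shift w x)) (shift v (shift w y))" using assms(2) unfolding agree_def by blast
  then show "U (shift (w + v) x) (shift (w + v) y)" by (simp add: add.commute)
qed

lemma agree_weaken: "agree S T w X \<Longrightarrow> (\<And>x y. T x y \<Longrightarrow> U x y) \<Longrightarrow> agree S U w X"
  unfolding agree_def by blast

lemma agree_iff:
  assumes "linking S" "linking T" "agree S T w X" "head x \<in> X"
  shows "T (shift w x) (shift w y) \<longleftrightarrow> S x y"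
proof
  assume T: "T (shift w x) (shift w y)"
  then have "x \<in> steps" using linkingD(1)[OF assms(2) T] by simp
  then obtain z where z: "S x z" using linking_ex assms(1) by blast
  then have "T (shift w x) (shift w z)" using assms(3,4) unfolding agree_def by blast
  then have "shift w y = shift w z" using T linking_unique[OF assms(2)] by blast
  then have "shift (- w) (shift w y) = shift (- w) (shift w z)" by simp
  then show "S x y" using z by simp
qed (use assms in \<open>auto simp: agree_def\<close>)

lemma lattice_box_shift: "lattice_box (x + w) h = (+) w ` lattice_box x h"
proof -
  have "y \<in> lattice_box (x + w) h \<longleftrightarrow> y - w \<in> lattice_box x h" for y
    by (cases x; cases y; cases w) (auto simp: algebra_simps)
  then show ?thesis by (auto intro: image_eqI[of _ _ "_ - w"]) (metis add_diff_cancel_left' )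
qed

lemma finite_lattice_box: "finite (lattice_box x h)"
proof -
  obtain a b c where x: "x = (a, b, c)" by (rule prod_cases3)
  have "lattice_box x h \<subseteq> {a - int h..a + int h} \<times> {b - int h..b + int h} \<times> {c - int h..c + int h}"
    by (auto simp: x)
  then show ?thesis by (rule finite_subset) simp
qed

text \<open>Both sets of curves contain all segments, so their patterns could differ only in
  connexions, and a connexion between segments of the box takes place at a point of the box.\<close>

lemma translation_equivI:
  assumes S: "linking S" "connexions F = seg_pairs S" "\<Union> (segs_of ` F) = segments"
    and T: "linking T" "connexions G = seg_pairs T" "\<Union> (segs_of ` G) = segments"
    and a: "agree S T w (lattice_box x h)"
  shows "translation_equiv (restrict_box F x h) (restrict_box G (x + w) h)"
proof -
  have sub: "(+) w ` s \<subseteq> lattice_box (x + w) h \<longleftrightarrow> s \<subseteq> lattice_box x h" for s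
    unfolding lattice_box_shift by (rule inj_image_subset_iff) simp
  have "(`) ((+) w) ` {s \<in> segments. s \<subseteq> lattice_box x h} = {s \<in> segments. s \<subseteq> lattice_box (x + w) h}"
  proof (intro set_eqI iffI)
    fix s assume "s \<in> (`) ((+) w) ` {s \<in> segments. s \<subseteq> lattice_box x h}"
    then obtain z where "s = (+) w ` seg z" "z \<in> steps" "seg z \<subseteq> lattice_box x h"
      unfolding segments_eq by blast
    then show "s \<in> {s \<in> segments. s \<subseteq> lattice_box (x + w) h}"
      using sub[of "seg z"] unfolding segments_eq seg_shift[symmetric] by auto
  next
    fix s assume "s \<in> {s \<in> segments. s \<subseteq> lattice_box (x + w) h}"
    then obtain z where z: "s = seg z" "z \<in> steps" "seg z \<subseteq> lattice_box (x + w) h"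
      unfolding segments_eq by blast
    then have s: "s = (+) w ` seg (shift (- w) z)" by (simp add: seg_shift[symmetric])
    then show "s \<in> (`) ((+) w) ` {s \<in> segments. s \<subseteq> lattice_box x h}"
      using z sub[of "seg (shift (- w) z)"] unfolding segments_eq by auto
  qed
  moreover have "map_prod ((`) ((+) w)) ((`) ((+) w)) `
      {(s, t) \<in> seg_pairs S. s \<subseteq> lattice_box x h \<and> t \<subseteq> lattice_box x h} =
      {(s, t) \<in> seg_pairs T. s \<subseteq> lattice_box (x + w) h \<and> t \<subseteq> lattice_box (x + w) h}"
  proof (intro set_eqI iffI)
    fix p assume "p \<in> map_prod ((`) ((+) w)) ((`) ((+) w)) `
      {(s, t) \<in> seg_pairs S. s \<subseteq> lattice_box x h \<and> t \<subseteq> lattice_box x h}"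
    then obtain y z where yz: "p = ((+) w ` seg y, (+) w ` seg z)" "S y z"
      "seg y \<subseteq> lattice_box x h" "seg z \<subseteq> lattice_box x h"
      unfolding seg_pairs_def by auto
    then have "T (shift w y) (shift w z)" using a unfolding agree_def by (simp add: seg_def)
    with yz sub[of "seg y"] sub[of "seg z"]
    show "p \<in> {(s, t) \<in> seg_pairs T. s \<subseteq> lattice_box (x + w) h \<and> t \<subseteq> lattice_box (x + w) h}"
      unfolding seg_pairs_def seg_shift[symmetric] by blast
  next
    fix p assume "p \<in> {(s, t) \<in> seg_pairs T. s \<subseteq> lattice_box (x + w) h \<and> t \<subseteq> lattice_box (x + w) h}"
    then obtain y' z' where yz': "p = (seg y', seg z')" "T y' z'"
      "seg y' \<subseteq> lattice_box (x + w) h" "seg z' \<subseteq> lattice_box (x + w) h"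
      unfolding seg_pairs_def by auto
    define y z where "y = shift (- w) y'" and "z = shift (- w) z'"
    then have eq: "y' = shift w y" "z' = shift w z" by simp_all
    then have in_box: "seg y \<subseteq> lattice_box x h" "seg z \<subseteq> lattice_box x h"
      using yz'(3,4) sub by (simp_all add: seg_shift)
    then have "S y z"
      using agree_iff[OF S(1) T(1) a, of y z] yz'(2) unfolding eq by (simp add: seg_def)
    then have "(seg y, seg z) \<in> seg_pairs S" unfolding seg_pairs_def by blast
    moreover have "p = map_prod ((`) ((+) w)) ((`) ((+) w)) (seg y, seg z)"
      using yz'(1) by (simp add: eq seg_shift)
    ultimately show "p \<in> map_prod ((`) ((+) w)) ((`) ((+) w)) `
      {(s, t) \<in> seg_pairs S. s \<subseteq> lattice_box x h \<and> t \<subseteq> lattice_box x h}"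
      using in_box by blast
  qed
  ultimately show ?thesis
    unfolding translation_equiv_def translate_def restrict_box_def S(2,3) T(2,3)
    by (intro exI[of _ w]) simp
qed

lemma translation_equiv_sym:
  assumes "translation_equiv p q" shows "translation_equiv q p"
proof -
  obtain w where w: "translate w p = q" using assms unfolding translation_equiv_def by blast
  have "translate (- w) (translate w p) = p"
    by (cases p) (simp add: translate_def image_comp comp_def map_prod_def case_prod_beta)
  then show ?thesis unfolding translation_equiv_def using w by blast
qed

lemma locally_isomorphicI:
  assumes S: "linking S" "connexions F = seg_pairs S" "\<Union> (segs_of ` F) = segments"
    and T: "linking T" "connexions G = seg_pairs T" "\<Union> (segs_of ` G) = segments"
    and ST: "\<And>X. finite X \<Longrightarrow> \<exists>w. agree S T w X" and TS: "\<And>X. finite X \<Longrightarrow> \<exists>w. agree T S w X"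
  shows "locally_isomorphic F G"
  unfolding locally_isomorphic_def
proof (intro conjI allI impI)
  fix h :: nat and x
  obtain w where "agree S T w (lattice_box x h)" using ST finite_lattice_box by blast
  from translation_equivI[OF S T this]
  show "\<exists>y. translation_equiv (restrict_box F x h) (restrict_box G y h)" by blast
next
  fix h :: nat and y
  obtain w where "agree T S w (lattice_box y h)" using TS finite_lattice_box by blast
  from translation_equivI[OF T S this]
  show "\<exists>x. translation_equiv (restrict_box F x h) (restrict_box G y h)"
    using translation_equiv_sym by blast
qed

lemma finite_ex_bound:
  fixes Q :: "'a \<Rightarrow> nat \<Rightarrow> bool"
  assumes "finite A" "\<And>a. a \<in> A \<Longrightarrow> \<exists>N. \<forall>k\<ge>N. Q a k"
  shows "\<exists>N. \<forall>a\<in>A. \<forall>k\<ge>N. Q a k"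
  using assms
proof (induction rule: finite_induct)
  case (insert a A)
  then obtain M N where "\<forall>k\<ge>M. Q a k" "\<forall>b\<in>A. \<forall>k\<ge>N. Q b k" by blast
  then show ?case by (intro exI[of _ "max M N"]) auto
qed simp

lemma finite_steps_head: "finite X \<Longrightarrow> finite {x \<in> steps. head x \<in> X}"
proof -
  assume "finite X"
  then have "finite (flip ` (X \<times> directions))" by (simp add: directions_def)
  moreover have "{x \<in> steps. head x \<in> X} \<subseteq> flip ` (X \<times> directions)"
  proof
    fix x assume "x \<in> {x \<in> steps. head x \<in> X}"
    then have "flip x \<in> X \<times> directions" using flip_steps[of x] by (simp add: steps_def mem_Times_iff)
    then show "x \<in> flip ` (X \<times> directions)" using flip_flip[of x] by (metis image_eqI)
  qed
  ultimately show ?thesis by (rule finite_subset[rotated])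
qed

section \<open>Recurrence of finite patterns and property (P)\<close>

lemma follows_periodic_on:
  assumes "finite X"
  shows "\<exists>N. \<forall>k\<ge>N. \<forall>w. agree follows follows (scale (2 ^ k) w) X"
proof -
  let ?A = "{x \<in> steps. head x \<in> X}"
  have "\<exists>N. \<forall>k\<ge>N. \<forall>w y. follows x y \<longrightarrow> follows (shift (scale (2 ^ k) w) x) (shift (scale (2 ^ k) w) y)" for x
  proof (cases "\<exists>y. follows x y")
    case True
    then obtain y where y: "follows x y" by blast
    then show ?thesis using follows_periodic[OF y] follows_unique by metis
  qed blast
  then obtain N where "\<forall>x\<in>?A. \<forall>k\<ge>N. \<forall>w y. follows x y \<longrightarrow> follows (shift (scale (2 ^ k) w) x) (shift (scale (2 ^ k) w) y)"
    using finite_ex_bound[OF finite_steps_head[OF assms],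
      of "\<lambda>x k. \<forall>w y. follows x y \<longrightarrow> follows (shift (scale (2 ^ k) w) x) (shift (scale (2 ^ k) w) y)"] by blast
  then show ?thesis unfolding agree_def using follows_steps by blast
qed

text \<open>Of the four ways to orient the two segments, the other three would make \<open>u\<close>
  or \<open>v\<close> zero or make the link turn back.\<close>

lemma R_at_iff:
  "(u, v) \<in> R_at x \<longleftrightarrow> u \<in> directions \<and> v \<in> directions \<and> follows (flip (x, u)) (x, v)"
proof -
  have "follows (flip (x, u)) (x, v)" if uv: "u \<in> directions" "v \<in> directions"
    and pair: "({x, x + u}, {x, x + v}) \<in> seg_pairs follows"
  proof -
    obtain a b where ab: "seg (x, u) = seg a" "seg (x, v) = seg b" "follows a b"
      using pair unfolding seg_pairs_def by (auto simp: seg_def)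
    have nz: "u \<noteq> 0" "v \<noteq> 0" using uv zero_notin_directions by auto
    have b: "fst b = head a" "b \<noteq> flip a" using ab(3) follows_head follows_not_flip by blast+
    consider "a = (x, u)" "b = (x, v)" | "a = (x, u)" "b = flip (x, v)"
      | "a = flip (x, u)" "b = flip (x, v)" | "a = flip (x, u)" "b = (x, v)"
      using ab(1,2) unfolding seg_eq_iff by (metis flip_flip)
    then show ?thesis
    proof cases
      case 1
      then show ?thesis using b nz by simp
    next
      case 2
      then show ?thesis using b by simp
    next
      case 3
      then show ?thesis using b nz by simp
    next
      case 4
      then show ?thesis using ab(3) by simp
    qed
  qed
  moreover have "({x, x + u}, {x, x + v}) \<in> seg_pairs follows" if "follows (flip (x, u)) (x, v)"
  proof -
    have "{x, x + u} = seg (flip (x, u))" "{x, x + v} = seg (x, v)" by (auto simp: seg_def)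
    then show ?thesis using that unfolding seg_pairs_def by blast
  qed
  ultimately show ?thesis unfolding R_at_def C_hat_connexions_eq by blast
qed

lemma theta_directions: "d \<in> directions \<Longrightarrow> theta d \<in> directions"
  and theta_theta: "d \<in> directions \<Longrightarrow> theta (theta d) = d"
  by (auto simp: directions_def theta_def e1_def e2_def e3_def)

lemma R_at_double:
  assumes "doubled p" shows "R_at (scale 2 p) = twist (R_at p)"
proof -
  have "(u, v) \<in> R_at (scale 2 p) \<longleftrightarrow> (u, v) \<in> twist (R_at p)" for u v
  proof (cases "u \<in> directions \<and> v \<in> directions")
    case True
    then show ?thesis
      using follows_theta[OF assms, of "theta u" "theta v"]
      by (simp add: R_at_iff twist_def theta_directions theta_theta del: step_pair_simps)
  qed (auto simp: R_at_iff twist_def)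
  then show ?thesis by (intro set_eqI) (metis surj_pair)
qed

lemma twist_twist: "R \<subseteq> directions \<times> directions \<Longrightarrow> twist (twist R) = R"
  unfolding twist_def using theta_directions theta_theta by auto

lemma R_at_power:
  assumes "doubled p" shows "R_at (scale (2 ^ (2 * k)) p) = R_at p"
proof (induction k)
  case (Suc k)
  have d: "doubled (scale a p)" for a using assms by (cases p) auto
  have "scale (2 ^ (2 * Suc k)) p = scale 2 (scale 2 (scale (2 ^ (2 * k)) p))" by simp
  then have "R_at (scale (2 ^ (2 * Suc k)) p) = twist (twist (R_at p))"
    using Suc by (simp only: R_at_double d doubled_scale)
  moreover have "R_at p \<subseteq> directions \<times> directions" unfolding R_at_def by blast
  ultimately show ?case by (simp add: twist_twist)
qed simp

lemma satisfies_P_agree: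
  assumes R: "satisfies_P R" and X: "finite X"
  shows "\<exists>w. agree (linked_at_0 R) follows w X"
proof -
  obtain x where "x \<in> {-2, 0, 2, 4} \<times> {-2, 0, 2, 4} \<times> {-2, 0, 2, 4} - {0, 4} \<times> {0, 4} \<times> {0, 4}"
    "R_at x = R \<or> R_at x = twist R"
    using conjunct2[OF R[unfolded satisfies_P_def]] by (rule bexE)
  then have x: "x \<in> {-2, 0, 2, 4} \<times> {-2, 0, 2, 4} \<times> {-2, 0, 2, 4}" "R_at x = R \<or> R_at x = twist R"
    using DiffD1 by metis+
  have "a mod 2 = 0" if "a \<in> {-2, 0, 2, 4}" for a :: int using that by auto
  then have dx: "doubled x" using x(1) by (cases x) (simp only: doubled.simps mem_Sigma_iff)
  have sub: "R \<subseteq> directions \<times> directions" using R unfolding satisfies_P_def pairing_def by blast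
  obtain N where N: "\<And>k w. k \<ge> N \<Longrightarrow> agree follows follows (scale (2 ^ k) w) X"
    using follows_periodic_on[OF X] by blast
  \<comment> \<open>An even exponent if R itself is seen at \<open>x\<close>, an odd one if its
    conjugate is; \<open>2 * N\<close> and \<open>2 * N + 1\<close> are both large enough for
    periodicity on \<open>X\<close>.\<close>
  obtain k where k: "k \<ge> N" "R_at (scale (2 ^ k) x) = R"
    using x(2)
  proof
    assume "R_at x = R"
    then have "R_at (scale (2 ^ (2 * N)) x) = R" using R_at_power[OF dx] by simp
    then show ?thesis using that[of "2 * N"] by simp
  next
    assume "R_at x = twist R"
    then have "R_at (scale 2 x) = R" using R_at_double[OF dx] twist_twist[OF sub] by simp
    then have "R_at (scale (2 ^ (2 * N)) (scale 2 x)) = R" using R_at_power[of "scale 2 x"] by simp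
    then show ?thesis using that[of "2 * N + 1"] by (simp add: mult.commute)
  qed
  \<comment> \<open>This translation preserves the links of \<open>follows\<close> on
    \<open>X\<close> and carries 0 to a point where the limit realizes R.\<close>
  have "agree (linked_at_0 R) follows (scale (2 ^ k) x) X"
    unfolding agree_def
  proof (intro allI impI)
    fix y z assume "head y \<in> X" "linked_at_0 R y z"
    then show "follows (shift (scale (2 ^ k) x) y) (shift (scale (2 ^ k) x) z)"
      unfolding linked_at_0_def
    proof (elim disjE exE conjE)
      assume "follows y z"
      then show ?thesis using N[OF k(1)] \<open>head y \<in> X\<close> unfolding agree_def by blast
    next
      fix u v assume uv: "(u, v) \<in> R" "y = flip (0, u)" "z = (0, v)"
      then have "(u, v) \<in> R_at (scale (2 ^ k) x)" using k(2) by simp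
      then have "follows (flip (scale (2 ^ k) x, u)) (scale (2 ^ k) x, v)" unfolding R_at_iff by blast
      then show ?thesis using uv(2,3) by (simp add: flip_shift[symmetric] add.commute)
    qed
  qed
  then show ?thesis by blast
qed

text \<open>On \<open>X\<close> the links of \<open>follows\<close> recur with period 2^N. A large
  part of S becomes a part of \<open>follows\<close> after a translation t; reducing t modulo 2^N
  finds in that part a translate of \<open>X\<close> that is aligned with the period.\<close>

lemma agree_follows_converse:
  assumes S: "linking S" "\<And>X. finite X \<Longrightarrow> \<exists>w. agree S follows w X" and X: "finite X"
  shows "\<exists>w. agree follows S w X"
proof -
  obtain N where N: "\<And>w. agree follows follows (scale (2 ^ N) w) X"
    using follows_periodic_on[OF X] by blast
  let ?B = "{0..<2 ^ N} \<times> {0..<2 ^ N} \<times> {0..<2 ^ N} :: point set"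
  \<comment> \<open>The residue of t is known only after the finite set has been fixed, so the set
    provides for all residues at once.\<close>
  have "finite ((\<lambda>(p, r). p - r) ` (X \<times> ?B))" using X by simp
  then obtain t where t: "agree S follows t ((\<lambda>(p, r). p - r) ` (X \<times> ?B))" using S(2) by blast
  obtain q a b c where q: "t = (a, b, c) + scale (2 ^ N) q"
    "a \<in> {0..<2 ^ N}" "b \<in> {0..<2 ^ N}" "c \<in> {0..<2 ^ N}"
    by (rule reduce_mod[of "2 ^ N" t]) auto
  define r where "r = (a, b, c)"
  have r: "r \<in> ?B" using q by (simp add: r_def)
  have tr: "t - r = scale (2 ^ N) q" using q(1) by (simp add: r_def)
  have "agree follows S (- r) X"
    unfolding agree_def
  proof (intro allI impI)
    fix x y assume x: "head x \<in> X" "follows x y"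
    then have "shift (- r) x \<in> steps" using follows_steps by simp
    then obtain z where z: "S (shift (- r) x) z" using linking_ex S(1) by blast
    have "head (shift (- r) x) \<in> (\<lambda>(p, r). p - r) ` (X \<times> ?B)"
      using x(1) r by (intro image_eqI[of _ _ "(head x, r)"]) auto
    then have "follows (shift t (shift (- r) x)) (shift t z)" using t z unfolding agree_def by blast
    then have "follows (shift (t - r) x) (shift t z)" by (simp add: add.commute)
    moreover have "follows (shift (t - r) x) (shift (t - r) y)" using N x unfolding agree_def tr by blast
    ultimately have "shift t z = shift (t - r) y" by (rule follows_unique)
    then have "shift (- t) (shift t z) = shift (- t) (shift (t - r) y)" by simp
    then show "S (shift (- r) x) (shift (- r) y)" using z by simp
  qed
  then show ?thesis by blast
qed

lemma locally_isomorphic_C_hat: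
  assumes S: "linking S" "connexions F = seg_pairs S" "\<Union> (segs_of ` F) = segments"
    and a: "\<And>X. finite X \<Longrightarrow> \<exists>w. agree S follows w X" and R: "satisfies_P R"
  shows "locally_isomorphic F (C_hat R)"
proof (rule locally_isomorphicI[OF S])
  have "pairing R" using R unfolding satisfies_P_def by blast
  then show l: "linking (linked_at_0 R)" by (rule linking_linked_at_0)
  show "connexions (C_hat R) = seg_pairs (linked_at_0 R)" "\<Union> (segs_of ` C_hat R) = segments"
    unfolding C_hat_eq using connexions_connected_by[OF l] segments_connected_by[OF l] by auto
  fix X :: "point set" assume X: "finite X"
  show "\<exists>w. agree S (linked_at_0 R) w X"
  proof -
    obtain w where "agree S follows w X" using a[OF X] by blast
    then have "agree S (linked_at_0 R) w X"
      by (rule agree_weaken) (simp add: linked_at_0_def)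
    then show ?thesis by blast
  qed
  obtain w where w: "agree (linked_at_0 R) follows w X" using satisfies_P_agree R X by blast
  obtain v where "agree follows S v ((+) w ` X)"
    using agree_follows_converse[OF S(1) a, of "(+) w ` X"] X by blast
  then show "\<exists>w. agree (linked_at_0 R) S w X" using agree_trans[OF w] by blast
qed

section \<open>The space-filling curve\<close>

lemma root_steps: "root \<in> steps"
  by (simp add: root_def steps_def directions_dirs dirs_def)

lemma drift_eq: "drift = scale 2 (5,-2,-1)"
  by (simp add: drift_def)

lemma pos_3: "pos 3 y i = sub (sub (sub y (i div 8 div 8 mod 8)) (i div 8 mod 8)) (i mod 8)"
  by (simp add: numeral_3_eq_3)

lemma pos_3_root: "pos 3 root 83 = shift drift root"
proof -
  \<comment> \<open>The digits of 83 in base 8 are 1, 2, 3.\<close>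
  have "sub (sub (sub root 1) 2) 3 = shift drift root" by code_simp
  then show ?thesis by (simp add: pos_3)
qed

lemma ancestor_steps:
  assumes "x \<in> steps"
  shows "\<exists>i. 0 \<le> i \<and> i < 512 \<and> shift drift x = pos 3 (ancestor x) i \<and> ancestor x \<in> steps"
    and "near (fst x + drift) (fst (fst (parent (shift drift x))))"
    and "near (fst (fst (parent (shift drift x)))) (fst (fst (parent (fst (parent (shift drift x))))))"
    and "near (fst (fst (parent (fst (parent (shift drift x)))))) (fst (ancestor x))"
proof -
  obtain y1 j1 where 1: "parent (shift drift x) = (y1, j1)" by (rule prod.exhaust)
  obtain y2 j2 where 2: "parent y1 = (y2, j2)" by (rule prod.exhaust)
  obtain y3 j3 where 3: "parent y2 = (y3, j3)" by (rule prod.exhaust)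
  have a: "ancestor x = y3" using 1 2 3 by (simp add: ancestor_def)
  have x: "shift drift x \<in> steps" using assms by simp
  have s1: "sub y1 j1 = shift drift x" "0 \<le> j1" "j1 < 8" "y1 \<in> steps" using sub_parent[OF x 1] by auto
  have s2: "sub y2 j2 = y1" "0 \<le> j2" "j2 < 8" "y2 \<in> steps" using sub_parent[OF s1(4) 2] by auto
  have s3: "sub y3 j3 = y2" "0 \<le> j3" "j3 < 8" "y3 \<in> steps" using sub_parent[OF s2(4) 3] by auto
  let ?i = "j1 + (j2 + j3 * 8) * 8"
  have i: "?i mod 8 = j1" "?i div 8 mod 8 = j2" "?i div 8 div 8 mod 8 = j3"
    using s1(2,3) s2(2,3) s3(2,3)
    by (simp_all only: mod_mult_self1 div_mult_self1[OF zero_neq_numeral[symmetric]]) simp_all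
  have "pos 3 y3 ?i = shift drift x"
    unfolding pos_3 i s3(1) s2(1) s1(1) ..
  moreover have "0 \<le> ?i" "?i < 512"
    using s1(2,3) s2(2,3) s3(2,3) by (simp_all add: distrib_right)
  ultimately show "\<exists>i. 0 \<le> i \<and> i < 512 \<and> shift drift x = pos 3 (ancestor x) i \<and> ancestor x \<in> steps"
    using s3(4) a by metis
  show "near (fst x + drift) (fst (fst (parent (shift drift x))))"
    using sub_near[OF s1(4,2,3)] by (simp add: s1(1) 1)
  show "near (fst (fst (parent (shift drift x)))) (fst (fst (parent (fst (parent (shift drift x))))))"
    using sub_near[OF s2(4,2,3)] by (simp add: s2(1) 1 2)
  show "near (fst (fst (parent (fst (parent (shift drift x)))))) (fst (ancestor x))"
    using sub_near[OF s3(4,2,3)] by (simp add: s3(1) 1 2 a)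
qed

text \<open>The translate of \<open>root\<close> by \<open>origin n\<close> is the step with index
  \<open>start n\<close> in the refinement of \<open>root\<close> of order 3 n.\<close>

primrec origin :: "nat \<Rightarrow> point" where
  "origin 0 = 0"
| "origin (Suc n) = scale 8 (origin n) + drift"

primrec start :: "nat \<Rightarrow> int" where
  "start 0 = 0"
| "start (Suc n) = 512 * start n + 83"

text \<open>The defining recursion refines the whole picture once more. This form instead adds a
  coarsest level and leaves the finer ones alone, which shows that the placements are
  nested.\<close>

lemma origin_Suc: "origin (Suc n) = origin n + scale (8 ^ n) drift"
proof (induction n)
  case (Suc n)
  have "origin (Suc (Suc n)) = scale 8 (origin n + scale (8 ^ n) drift) + drift"
    using Suc by simp
  also have "\<dots> = origin (Suc n) + scale (8 ^ Suc n) drift"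
    by (simp add: scale_add algebra_simps)
  finally show ?case .
qed (simp add: drift_def zero_prod_def)

lemma start_Suc: "start (Suc n) = start n + 83 * 512 ^ n"
proof (induction n)
  case (Suc n)
  have "start (Suc (Suc n)) = 512 * (start n + 83 * 512 ^ n) + 83" using Suc by simp
  also have "\<dots> = start (Suc n) + 83 * 512 ^ Suc n" by simp
  finally show ?case .
qed simp

lemma origin_even: "\<exists>p. origin n = scale 2 p"
proof (induction n)
  case 0
  show ?case by (intro exI[of _ 0]) simp
next
  case (Suc n)
  then obtain p where "origin n = scale 2 p" by blast
  then have "origin (Suc n) = scale 2 (scale 8 p + (5,-2,-1))"
    by (simp add: scale_add drift_def)
  then show ?case by blast
qed

text \<open>As 83 is neither 0 nor 511, the copy of \<open>root\<close> is not at an end of its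
  refinement and the windows grow on both sides. With \<open>start_less\<close>,
  \<open>window n\<close> contains all indices of absolute value at most n.\<close>

lemma start_ge: "int n \<le> start n"
  by (induction n) auto

lemma start_less: "start n + int n < 512 ^ n"
  by (induction n) auto

lemma power_8_3: "(8 :: int) ^ (3 * n) = 512 ^ n"
  by (simp add: power_mult)

text \<open>\<open>placed n\<close> is the \<open>3 n\<close>-th refinement of \<open>root\<close>, translated and reindexed so that it extends
  \<open>placed (n - 1)\<close>; only the indices in \<open>window n\<close> are meaningful.\<close>

definition window :: "nat \<Rightarrow> int set" where
  "window n = {j. 0 \<le> j + start n \<and> j + start n < 512 ^ n}"

definition placed :: "nat \<Rightarrow> int \<Rightarrow> step" where
  "placed n j = shift (- origin n) (pos (3 * n) root (j + start n))"

text \<open>The three leading base 8 digits of the new index are those of 83, which lead to the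
  translate of \<open>root\<close>; the remaining digits are those of the old index.\<close>

lemma placed_Suc:
  assumes "j \<in> window n" shows "j \<in> window (Suc n) \<and> placed (Suc n) j = placed n j"
proof
  have j: "0 \<le> j + start n" "j + start n < 512 ^ n" using assms by (simp_all add: window_def)
  have i: "j + start (Suc n) = (j + start n) + 83 * 512 ^ n" by (simp only: start_Suc)
  have "0 \<le> (512::int) ^ n" by simp
  then have "(j + start n) + 83 * 512 ^ n < 512 * 512 ^ n" "0 \<le> (j + start n) + 83 * 512 ^ n"
    using j by linarith+
  then show "j \<in> window (Suc n)" by (simp only: window_def mem_Collect_eq i power_Suc simp_thms)
  have "(j + start (Suc n)) div 512 ^ n = 83" "(j + start (Suc n)) mod 512 ^ n = j + start n"
    unfolding i using j by simp_all
  then have "pos (3 * n + 3) root (j + start (Suc n)) = pos (3 * n) (shift drift root) (j + start n)"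
    using pos_3_root by (simp add: pos_add power_8_3)
  also have "\<dots> = shift (scale (2 ^ (3 * n + 1)) (5,-2,-1)) (pos (3 * n) root (j + start n))"
    unfolding drift_eq by (rule pos_shift[OF root_steps])
  also have "scale (2 ^ (3 * n + 1)) (5,-2,-1) = scale (8 ^ n) drift"
    by (simp add: drift_def power_mult)
  finally have "placed (Suc n) j
      = shift (- origin (Suc n)) (shift (scale (8 ^ n) drift) (pos (3 * n) root (j + start n)))"
    by (simp add: placed_def add.commute)
  also have "\<dots> = placed n j"
    unfolding origin_Suc placed_def by simp
  finally show "placed (Suc n) j = placed n j" .
qed

lemma placed_mono:
  assumes "j \<in> window n" "n \<le> m" shows "j \<in> window m \<and> placed m j = placed n j"
  using assms(2) by (induction m rule: dec_induct) (use assms(1) placed_Suc in auto)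

text \<open>All stages whose window contains \<open>j\<close> give the same step; the stage chosen
  here is one of them.\<close>

definition thread :: "int \<Rightarrow> step" where
  "thread j = placed (nat \<bar>j\<bar>) j"

lemma window_nat_abs: "nat \<bar>j\<bar> \<le> n \<Longrightarrow> j \<in> window n"
  using start_ge[of n] start_less[of n] by (auto simp: window_def)

lemma thread_eq:
  assumes "j \<in> window n" shows "thread j = placed n j"
proof -
  have "j \<in> window (nat \<bar>j\<bar>)" by (rule window_nat_abs) simp
  then have "placed (max n (nat \<bar>j\<bar>)) j = thread j"
    using placed_mono[of j "nat \<bar>j\<bar>" "max n (nat \<bar>j\<bar>)"] unfolding thread_def by simp
  moreover have "placed (max n (nat \<bar>j\<bar>)) j = placed n j"
    using placed_mono[OF assms, of "max n (nat \<bar>j\<bar>)"] by simp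
  ultimately show ?thesis by simp
qed

lemma shift_thread:
  assumes "nat \<bar>j\<bar> \<le> n" shows "shift (origin n) (thread j) = pos (3 * n) root (j + start n)"
  using thread_eq[OF window_nat_abs[OF assms]] by (simp add: placed_def)

lemma follows_thread:
  assumes "nat \<bar>j\<bar> < n"
  shows "follows (shift (origin n) (thread j)) (shift (origin n) (thread (j + 1)))"
proof -
  have "nat \<bar>j\<bar> \<le> n" "nat \<bar>j + 1\<bar> \<le> n" using assms by auto
  moreover from this have "j \<in> window n" "j + 1 \<in> window n" by (auto intro: window_nat_abs)
  then have "0 \<le> j + start n" "j + start n + 1 < 8 ^ (3 * n)" by (simp_all add: window_def power_8_3)
  ultimately show ?thesis
    using follows_pos[OF root_steps, of "j + start n" "3 * n"] by (simp add: shift_thread algebra_simps)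
qed

lemma thread_steps: "thread j \<in> steps"
  by (simp add: thread_def placed_def pos_steps root_steps)

lemma fst_thread: "fst (thread (j + 1)) = head (thread j)"
  using follows_head[OF follows_thread[of j "nat \<bar>j\<bar> + 1"]] by simp

lemma thread_not_flip: "thread (j + 1) \<noteq> flip (thread j)"
  using follows_not_flip[OF follows_thread[of j "nat \<bar>j\<bar> + 1"]] by (auto simp: flip_shift)

lemma thread_inject:
  assumes "thread i = thread j \<or> thread i = flip (thread j)"
  shows "i = j \<and> thread i \<noteq> flip (thread j)"
proof -
  define n where "n = max (nat \<bar>i\<bar>) (nat \<bar>j\<bar>)"
  have n: "nat \<bar>i\<bar> \<le> n" "nat \<bar>j\<bar> \<le> n" by (simp_all add: n_def)
  then have "i \<in> window n" "j \<in> window n" by (auto intro: window_nat_abs)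
  then have w: "0 \<le> i + start n" "i + start n < 8 ^ (3 * n)" "0 \<le> j + start n" "j + start n < 8 ^ (3 * n)"
    by (simp_all add: window_def power_8_3)
  have not: "thread i \<noteq> flip (thread j)"
  proof
    assume "thread i = flip (thread j)"
    then have "shift (origin n) (thread i) = flip (shift (origin n) (thread j))"
      by (simp add: flip_shift)
    then have "pos (3 * n) root (i + start n) = pos (3 * n) (flip root) (8 ^ (3 * n) - 1 - (j + start n))"
      using n root_steps by (simp add: shift_thread pos_flip)
    then have "root = flip root"
      using w root_steps by (subst (asm) pos_inject) auto
    then show False using flip_neq[OF root_steps] by simp
  qed
  then have "shift (origin n) (thread i) = shift (origin n) (thread j)" using assms by simp
  then have "pos (3 * n) root (i + start n) = pos (3 * n) root (j + start n)"
    using n by (simp add: shift_thread)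
  then have "i = j" using w root_steps by (subst (asm) pos_inject) auto
  then show ?thesis using not by simp
qed

section \<open>The thread passes through every segment\<close>

definition on_thread :: "step \<Rightarrow> bool" where
  "on_thread x \<longleftrightarrow> (\<exists>j. x = thread j \<or> x = flip (thread j))"

lemma on_thread_flip [simp]: "on_thread (flip x) \<longleftrightarrow> on_thread x"
  unfolding on_thread_def by (metis flip_flip)

text \<open>Refining three times and translating by \<open>- drift\<close> carries stage
  \<open>n\<close> of the thread to stage \<open>Suc n\<close>, by the defining recursion of
  \<open>origin\<close>; hence the thread contains its own image.\<close>

lemma on_thread_descend:
  assumes "shift drift x = pos 3 (thread j) i" "0 \<le> i" "i < 512"
  shows "on_thread x"
proof -
  define n where "n = nat \<bar>j\<bar>"
  obtain p where p: "origin n = scale 2 p" using origin_even by blast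
  define k where "k = i + (j + start n) * 512"
  have j: "j \<in> window n" using window_nat_abs unfolding n_def by simp
  then have "0 \<le> k" "k < 512 ^ Suc n" using assms(2,3) by (auto simp: window_def k_def)
  then have w: "k - start (Suc n) \<in> window (Suc n)" by (simp add: window_def)
  have "k div 512 = j + start n + i div 512" "k mod 512 = i mod 512"
    unfolding k_def by (rule div_mult_self1, simp, rule mod_mult_self1)
  then have k: "k div 8 ^ 3 = j + start n" "k mod 8 ^ 3 = i" using assms(2,3) by simp_all
  have "thread j = shift (scale 2 (- p)) (pos (3 * n) root (j + start n))"
    using thread_eq[OF j] by (simp add: placed_def p scale_minus)
  then have "shift drift x = shift (scale (2 ^ (3 + 1)) (- p)) (pos 3 (pos (3 * n) root (j + start n)) i)"
    using assms(1) pos_shift[OF pos_steps[OF root_steps]] by simp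
  also have "pos 3 (pos (3 * n) root (j + start n)) i = pos (3 + 3 * n) root k"
    unfolding pos_add k ..
  also have "scale (2 ^ (3 + 1)) (- p) = - scale 8 (origin n)" by (simp add: p scale_minus)
  finally have "shift (- drift) (shift drift x) = shift (- drift) (shift (- scale 8 (origin n)) (pos (3 + 3 * n) root k))"
    by (rule arg_cong)
  moreover have "- drift + - scale 8 (origin n) = - origin (Suc n)" by simp
  ultimately have "x = placed (Suc n) (k - start (Suc n))"
    by (simp only: placed_def shift_shift left_minus shift_0 diff_add_cancel mult_Suc_right)
  then show ?thesis using thread_eq[OF w] unfolding on_thread_def by metis
qed

lemma on_thread_ancestor:
  assumes x: "x \<in> steps" and a: "on_thread (ancestor x)" shows "on_thread x"
proof -
  obtain i where i: "0 \<le> i" "i < 512" "shift drift x = pos 3 (ancestor x) i" "ancestor x \<in> steps"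
    using ancestor_steps(1)[OF x] by blast
  obtain j where "ancestor x = thread j \<or> ancestor x = flip (thread j)"
    using a unfolding on_thread_def by blast
  then show ?thesis
  proof
    assume "ancestor x = thread j"
    then show ?thesis using i on_thread_descend by metis
  next
    assume "ancestor x = flip (thread j)"
    \<comment> \<open>Reversal complements the three digits of the index.\<close>
    then have "shift drift (flip x) = pos 3 (thread j) (511 - i)"
      using i(3) thread_steps[of j] by (simp add: flip_shift[symmetric] pos_flip)
    then have "on_thread (flip x)" by (rule on_thread_descend) (use i in auto)
    then show ?thesis by simp
  qed
qed

lemma thread_0: "thread 0 = root"
  by (simp add: thread_def placed_def)

text \<open>Seven times the distance from \<open>drift / 7\<close>, the fixed point of the contraction
  \<open>p \<mapsto> (p + drift) / 8\<close> that approximates \<open>ancestor\<close>.\<close>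

fun spread :: "point \<Rightarrow> int" where
  "spread (a, b, c) = max \<bar>7 * a - 10\<bar> (max \<bar>7 * b + 4\<bar> \<bar>7 * c + 2\<bar>)"

text \<open>Through three parents the errors add up to 2 + 4 + 8 = 14, and the factor 7 makes this
  98. Here \<open>q\<close> is a coordinate of \<open>drift\<close>.\<close>

lemma spread_coordinate:
  fixes a b c d q :: int
  assumes "\<bar>a + q - 2 * b\<bar> \<le> 2" "\<bar>b - 2 * c\<bar> \<le> 2" "\<bar>c - 2 * d\<bar> \<le> 2"
  shows "8 * \<bar>7 * d - q\<bar> \<le> \<bar>7 * a - q\<bar> + 98"
proof -
  have "\<bar>a + q - 8 * d\<bar> \<le> 14" using assms by linarith
  then have "\<bar>7 * (a + q - 8 * d)\<bar> \<le> 98" by (simp only: abs_mult) simp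
  moreover have "8 * (7 * d - q) = (7 * a - q) - 7 * (a + q - 8 * d)" by (simp add: algebra_simps)
  then have "\<bar>8 * (7 * d - q)\<bar> \<le> \<bar>7 * a - q\<bar> + \<bar>7 * (a + q - 8 * d)\<bar>"
    using abs_triangle_ineq4[of "7 * a - q" "7 * (a + q - 8 * d)"] by (simp only:)
  moreover have "\<bar>8 * (7 * d - q)\<bar> = 8 * \<bar>7 * d - q\<bar>" by (simp only: abs_mult abs_numeral)
  ultimately show ?thesis by linarith
qed

lemma spread_near:
  assumes "near (p + drift) p1" "near p1 p2" "near p2 p3"
  shows "8 * spread p3 \<le> spread p + 98"
proof -
  obtain a b c where p: "p = (a, b, c)" by (rule prod_cases3)
  obtain a1 b1 c1 where p1: "p1 = (a1, b1, c1)" by (rule prod_cases3)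
  obtain a2 b2 c2 where p2: "p2 = (a2, b2, c2)" by (rule prod_cases3)
  obtain a3 b3 c3 where p3: "p3 = (a3, b3, c3)" by (rule prod_cases3)
  have "8 * \<bar>7 * a3 - 10\<bar> \<le> \<bar>7 * a - 10\<bar> + 98" "8 * \<bar>7 * b3 + 4\<bar> \<le> \<bar>7 * b + 4\<bar> + 98"
    "8 * \<bar>7 * c3 + 2\<bar> \<le> \<bar>7 * c + 2\<bar> + 98"
    using spread_coordinate[of a 10 a1 a2 a3] spread_coordinate[of b "-4" b1 b2 b3]
      spread_coordinate[of c "-2" c1 c2 c3] assms
    by (simp_all add: p p1 p2 p3 drift_def)
  then show ?thesis by (simp add: p p3 max_def)
qed

lemma spread_small:
  assumes "x \<in> steps" "spread (fst x) \<le> 14"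
  shows "x \<in> set (List.product (points_in [0,1,2,3] [-2,-1,0,1] [-2,-1,0,1]) dirs)"
proof -
  obtain a b c d where x: "x = ((a, b, c), d)" by (metis prod.exhaust)
  have "a \<in> {0..<4}" "b \<in> {-2..<2}" "c \<in> {-2..<2}"
    using assms(2) by (auto simp: x)
  moreover have "{0..<4} = set [0,1,2,3::int]" "{-2..<2} = set [-2,-1,0,1::int]" by auto
  ultimately show ?thesis
    using assms(1) by (simp_all only: x points_in_def steps_def directions_dirs set_product
        mem_Times_iff fst_conv snd_conv simp_thms)
qed

lemma on_thread_all: "x \<in> steps \<Longrightarrow> on_thread x"
proof (induction "nat (spread (fst x))" arbitrary: x rule: less_induct)
  case less
  note a = ancestor_steps[OF less.prems]
  show ?case
  \<comment> \<open>14 solves 8 s = s + 98: above it the ancestor has strictly smaller spread, up to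
    it the finite check applies.\<close>
  proof (cases "spread (fst x) \<le> 14")
    case True
    then have "descent_ok x"
      using descent_check spread_small[OF less.prems] by (simp only: list_all_iff)
    then have "ancestor (ancestor (ancestor x)) = root \<or> ancestor (ancestor (ancestor x)) = flip root"
      by (simp add: descent_ok_def)
    moreover have "on_thread root" unfolding on_thread_def using thread_0 by metis
    ultimately have "on_thread (ancestor (ancestor (ancestor x)))" by auto
    moreover have "ancestor x \<in> steps" "ancestor (ancestor x) \<in> steps"
      using ancestor_steps(1) less.prems by blast+
    ultimately show ?thesis using on_thread_ancestor less.prems by blast
  next
    case False
    have "8 * spread (fst (ancestor x)) \<le> spread (fst x) + 98"
      using a(2-4) by (rule spread_near)
    then have "nat (spread (fst (ancestor x))) < nat (spread (fst x))" using False by linarith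
    then have "on_thread (ancestor x)" using less.hyps a(1) by blast
    then show ?thesis using on_thread_ancestor less.prems by blast
  qed
qed

section \<open>The thread as a covering curve\<close>

definition threaded :: "step \<Rightarrow> step \<Rightarrow> bool" where
  "threaded x y \<longleftrightarrow> (\<exists>i. x = thread i \<and> y = thread (i + 1) \<or> x = flip (thread (i + 1)) \<and> y = flip (thread i))"

lemma threaded_forward: "threaded (thread i) y \<longleftrightarrow> y = thread (i + 1)"
  unfolding threaded_def using thread_inject by metis

lemma threaded_backward: "threaded (flip (thread i)) y \<longleftrightarrow> y = flip (thread (i - 1))"
proof -
  have "threaded (flip (thread i)) y \<longleftrightarrow> (\<exists>j. thread i = thread (j + 1) \<and> y = flip (thread j))"
    unfolding threaded_def using thread_inject by (metis flip_flip)
  also have "\<dots> \<longleftrightarrow> (\<exists>j. i = j + 1 \<and> y = flip (thread j))" using thread_inject by metis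
  also have "\<dots> \<longleftrightarrow> y = flip (thread (i - 1))" by (metis add_diff_cancel_right' diff_add_cancel)
  finally show ?thesis .
qed

text \<open>Every step has a continuation because the thread passes through all segments, and only
  one because it is self-avoiding.\<close>

lemma linking_threaded: "linking threaded"
proof -
  have "x \<in> steps \<and> y \<in> steps \<and> fst y = head x \<and> y \<noteq> flip x \<and> threaded (flip y) (flip x)"
    if xy: "threaded x y" for x y
  proof -
    obtain i where i: "x = thread i \<and> y = thread (i + 1) \<or> x = flip (thread (i + 1)) \<and> y = flip (thread i)"
      using xy unfolding threaded_def by blast
    have "threaded (flip y) (flip x)" using i unfolding threaded_def by (metis flip_flip)
    moreover have "y \<noteq> flip x" using i thread_not_flip[of i] by (metis flip_flip)
    moreover have "x \<in> steps \<and> y \<in> steps \<and> fst y = head x"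
      using i fst_thread[of i] thread_steps by auto
    ultimately show ?thesis by blast
  qed
  moreover have "\<exists>!y. threaded x y" if "x \<in> steps" for x
    using on_thread_all[OF that] threaded_forward threaded_backward unfolding on_thread_def by metis
  ultimately show ?thesis unfolding linking_def by blast
qed

text \<open>The link from \<open>thread i\<close> to its successor belongs to all sufficiently late
  stages, so finitely many links share a stage; translating by its \<open>origin\<close> makes them
  links of a power of C.\<close>

lemma threaded_agree:
  assumes "finite X" shows "\<exists>w. agree threaded follows w X"
proof -
  let ?Q = "\<lambda>x n. \<forall>y. threaded x y \<longrightarrow> follows (shift (origin n) x) (shift (origin n) y)"
  have "\<exists>N. \<forall>n\<ge>N. ?Q x n" if "x \<in> {x \<in> steps. head x \<in> X}" for x
  proof -
    have "x \<in> steps" using that by blast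
    then obtain y where y: "threaded x y" using linking_ex[OF linking_threaded] by blast
    then obtain i where i: "x = thread i \<and> y = thread (i + 1) \<or> x = flip (thread (i + 1)) \<and> y = flip (thread i)"
      unfolding threaded_def by blast
    have "follows (shift (origin n) x) (shift (origin n) y)" if "n > nat \<bar>i\<bar>" for n
      using i follows_thread[OF that] follows_flip[OF follows_thread[OF that]]
      by (auto simp: flip_shift)
    then have "?Q x n" if "n \<ge> nat \<bar>i\<bar> + 1" for n
      using that linking_unique[OF linking_threaded y] by (metis Suc_eq_plus1 Suc_le_lessD)
    then show ?thesis by blast
  qed
  then obtain N where "\<forall>x\<in>{x \<in> steps. head x \<in> X}. \<forall>n\<ge>N. ?Q x n"
    using finite_ex_bound[OF finite_steps_head[OF assms], of ?Q] by blast
  then have "agree threaded follows (origin N) X"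
    unfolding agree_def using linkingD(1)[OF linking_threaded] by blast
  then show ?thesis by blast
qed

definition thread_curve :: curve where
  "thread_curve = nonoriented (\<lambda>i. Some (seg (thread i)))"

lemma thread_curveE:
  assumes "f \<in> thread_curve"
  obtains k where "f = (\<lambda>i. Some (seg (thread (k + i)))) \<or> f = (\<lambda>i. Some (seg (thread (k - i))))"
  using assms unfolding thread_curve_def nonoriented_def by blast

lemma segs_of_thread_curve: "segs_of thread_curve = segments"
proof
  show "segs_of thread_curve \<subseteq> segments"
  proof
    fix s assume "s \<in> segs_of thread_curve"
    then obtain f where f: "f \<in> thread_curve" "s \<in> ran f" unfolding segs_of_def by blast
    obtain k where "f = (\<lambda>i. Some (seg (thread (k + i)))) \<or> f = (\<lambda>i. Some (seg (thread (k - i))))"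
      by (rule thread_curveE[OF f(1)])
    then show "s \<in> segments" using f(2) thread_steps unfolding segments_eq by (auto simp: ran_def)
  qed
  show "segments \<subseteq> segs_of thread_curve"
  proof
    fix s assume "s \<in> segments"
    then obtain x where x: "x \<in> steps" "s = seg x" unfolding segments_eq by blast
    then obtain j where "x = thread j \<or> x = flip (thread j)"
      using on_thread_all unfolding on_thread_def by blast
    then have "s \<in> ran (\<lambda>i. Some (seg (thread i)))" using x(2) by (auto simp: ran_def)
    then show "s \<in> segs_of thread_curve"
      unfolding segs_of_def thread_curve_def by (rule UN_I[OF nonoriented_self])
  qed
qed

lemma connexions_thread_curve: "connexions {thread_curve} = seg_pairs threaded"
proof (intro set_eqI iffI)
  fix st assume "st \<in> connexions {thread_curve}"
  then obtain f i s t where f: "st = (s, t)" "f \<in> thread_curve" "f i = Some s" "f (i + 1) = Some t"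
    unfolding connexions_def by blast
  obtain k where "f = (\<lambda>i. Some (seg (thread (k + i)))) \<or> f = (\<lambda>i. Some (seg (thread (k - i))))"
    by (rule thread_curveE[OF f(2)])
  then show "st \<in> seg_pairs threaded"
  proof
    assume "f = (\<lambda>i. Some (seg (thread (k + i))))"
    then have "s = seg (thread (k + i))" "t = seg (thread (k + i + 1))"
      using f(3,4) by (simp_all add: add.assoc)
    then show ?thesis using threaded_forward f(1) unfolding seg_pairs_def by blast
  next
    assume "f = (\<lambda>i. Some (seg (thread (k - i))))"
    then have "s = seg (flip (thread (k - i)))" "t = seg (flip (thread (k - i - 1)))"
      using f(3,4) by (simp_all add: diff_diff_eq)
    then show ?thesis using threaded_backward f(1) unfolding seg_pairs_def by blast
  qed
next
  fix st assume "st \<in> seg_pairs threaded"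
  then obtain x y where xy: "st = (seg x, seg y)" "threaded x y" unfolding seg_pairs_def by blast
  let ?f = "\<lambda>i. Some (seg (thread i))"
  have "\<exists>f\<in>thread_curve. \<exists>i. f i = Some (seg x) \<and> f (i + 1) = Some (seg y)"
  proof -
    obtain i where "x = thread i \<and> y = thread (i + 1) \<or> x = flip (thread (i + 1)) \<and> y = flip (thread i)"
      using xy(2) unfolding threaded_def by blast
    then show ?thesis
    proof
      assume "x = thread i \<and> y = thread (i + 1)"
      then show ?thesis unfolding thread_curve_def by (intro bexI[OF _ nonoriented_self] exI[of _ i]) simp
    next
      assume xy: "x = flip (thread (i + 1)) \<and> y = flip (thread i)"
      have "(\<lambda>j. ?f (i + 1 - j)) \<in> thread_curve" unfolding thread_curve_def nonoriented_def by blast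
      then show ?thesis using xy by (intro bexI[of _ "\<lambda>j. ?f (i + 1 - j)"] exI[of _ 0]) simp_all
    qed
  qed
  then show "st \<in> connexions {thread_curve}" unfolding connexions_def xy(1) by simp
qed

lemma covering_thread_curve: "covering {thread_curve}"
  unfolding covering_def
proof (intro conjI ballI)
  have "curve_seq (\<lambda>i. Some (seg (thread i)))"
    by (rule walk_curve_seq[OF linking_threaded]) (simp add: threaded_forward)
  then show "{thread_curve} \<subseteq> curves" unfolding thread_curve_def curves_def by blast
  fix \<gamma> assume "\<gamma> \<in> {thread_curve}"
  then have \<gamma>: "\<gamma> = thread_curve" by simp
  show "self_avoiding \<gamma>"
    unfolding self_avoiding_def \<gamma>
  proof
    fix f assume f: "f \<in> thread_curve"
    have inj: "seg (thread i) = seg (thread j) \<Longrightarrow> i = j" for i j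
      using thread_inject unfolding seg_eq_iff by blast
    obtain k where "f = (\<lambda>i. Some (seg (thread (k + i)))) \<or> f = (\<lambda>i. Some (seg (thread (k - i))))"
      by (rule thread_curveE[OF f])
    then show "inj_on f (dom f)"
      using inj by (auto simp: inj_on_def dest!: inj)
  qed
next
  fix s assume "s \<in> segments"
  then show "\<exists>!\<gamma>. \<gamma> \<in> {thread_curve} \<and> s \<in> segs_of \<gamma>"
    by (intro ex1I[of _ thread_curve]) (simp_all add: segs_of_thread_curve)
qed

theorem theorem2p9:
  "\<exists>\<gamma> :: curve. covering {\<gamma>} \<and>
     (\<forall>R. satisfies_P R \<longrightarrow> locally_isomorphic {\<gamma>} (C_hat R))"
proof (intro exI[of _ thread_curve] conjI allI impI)
  show "covering {thread_curve}" by (rule covering_thread_curve)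
  fix R assume "satisfies_P R"
  from locally_isomorphic_C_hat[OF linking_threaded connexions_thread_curve _ threaded_agree this]
  show "locally_isomorphic {thread_curve} (C_hat R)" by (simp add: segs_of_thread_curve)
qed

end
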